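(* Let $H_1$ be the subgroup of $GL_2(\mathbb{C})$ generated by \[ \frac{1}{2}\begin{pmatrix}1+\sqrt{-1}&1+\sqrt{-1}\\ 1+\sqrt{-1}&1-\sqrt{-1}\end{pmatrix} \quad\text{and}\quad \begin{pmatrix}1&0\\ 0&\sqrt{-1}\end{pmatrix}, \] a finite group acting linearly on the variables $(x_0,x_1)$ (via $\sigma\cdot {}^t(x_0,x_1)$). For a positive integer $\ell$ let \[ \varphi_\ell^{H_1}(x_0,x_1)=\frac{1}{|H_1|}\sum_{\sigma\in H_1}(\sigma x_0)^\ell , \] where $\sigma x_0$ denotes the first coordinate of $\sigma\,{}^t(x_0,x_1)$. Whenever $\varphi_\ell^{H_1}\not\equiv 0$, let $\widetilde{\varphi_\ell^{H_1}}$ denote $\varphi_\ell^{H_1}$ divided by its coefficient of $x_0^\ell$, and let $P_\ell(T)$ be the zeta polynomial of $\widetilde{\varphi_\ell^{H_1}}$ with respect to $q=2$ (defined in the context). Then, for all $\ell$ with $\varphi_\ell^{H_1}\not\equiv 0$ (resp. $\varphi_\ell^{H_1},\varphi_{\ell+4}^{H_1}\not\equiv0$): (I)(1) all zeros of $P_\ell(T)$ have absolute value $1/\sqrt{2}$; (I)(2) the zeros of $P_\ell(T)$ interlace those of $P_{\ell+4}(T)$; (I)(3) for every prime $p\ge 7$ (i.e. $p$ odd, $p\neq 3,5$), all coefficients of $P_{2(p-1)}(T)$ are $p$-integral rational numbers; (II) for every prime $p\ge 5$, all coefficients of $\widetilde{\varphi_{2(p-1)}^{H_1}}(x_0,x_1)$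 are $p$-integral; (III) for every prime $p\ge 5$, let $\theta_0(\tau)=\sum_{b\in\mathbb{Z},\,b\equiv 0 \pmod 2}\exp(\pi i b^2\tau/2)$ and $\theta_1(\tau)=\sum_{b\in\mathbb{Z},\,b\equiv 1\pmod 2}\exp(\pi i b^2\tau/2)$, both power series in $Q=e^{\pi i\tau/2}$ with integer coefficients; then the power series $\widetilde{\varphi_{2(p-1)}^{H_1}}(\theta_0(\tau),\theta_1(\tau))$ in $Q$ has all coefficients $p$-integral.
   Context: A rational number $a$ is $p$-integral if $v_p(a)\ge 0$, where $v_p$ is the $p$-adic valuation. It is known that $\varphi_\ell^{H_1}\not\equiv 0$ exactly when $\ell\equiv 0\pmod 4$ and $\ell\ge 8$. A formal weight enumerator of degree $n$ is a homogeneous polynomial $f\in\mathbb{C}[x_0,x_1]$ of degree $n$ with coefficient of $x_0^n$ equal to $1$; writing $f=x_0^n+\sum_{i=d}^n A_i x_0^{n-i}x_1^i$ with $A_d\neq0$, $d$ is its minimum distance. For $q\neq 1$ real, the zeta polynomial $P_f(T)$ of $f$ with respect to $q$ is the unique polynomial in $\mathbb{C}[T]$ of degree at most $n-d$ such that the coefficient of $T^{n-d}$ in the power series $\frac{P_f(T)}{(1-T)(1-qT)}(x_0T+x_1(1-T))^n$ equals $\frac{f(x_0,x_1)-x_0^n}{q-1}$. Interlacing in (I)(2) means: the zeros of both polynomials lie on the circle $|T|=1/\sqrt2$, and, ordered by argument around this circle, between any two consecutive zeros of one polynomial there lies a zero of the other.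
   Formalization: The lower right entry of the first generator is taken as -(1+i)/2, since as printed the group is infinite; in (I)(2) interlacing means a zero of P_{l+4} lies between any two consecutive zeros of P_l, as the reverse direction fails. *)

theory Defs
  imports
    "HOL-Analysis.Analysis"
    "HOL-Algebra.Generated_Groups"
    "HOL-Computational_Algebra.Computational_Algebra"
begin

text \<open>
  The ring \<open>\<complex>[x\<^sub>0, x\<^sub>1]\<close> is rendered as \<^typ>\<open>complex poly poly\<close>: the outer variable
  is \<open>x\<^sub>0\<close> and the variable of the coefficient polynomials is \<open>x\<^sub>1\<close>.
\<close>

definition x0 :: "complex poly poly" where
  "x0 = [:0, 1:]"

definition x1 :: "complex poly poly" where
  "x1 = [:[:0, 1:]:]"

definition const2 :: "complex \<Rightarrow> complex poly poly" where
  "const2 c = [:[:c:]:]"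

text \<open>\<open>coeff2 f i j\<close> is the coefficient of \<open>x\<^sub>0\<^sup>i x\<^sub>1\<^sup>j\<close>; \<open>eval2 f a b\<close> is \<open>f(a, b)\<close>.\<close>

definition coeff2 :: "complex poly poly \<Rightarrow> nat \<Rightarrow> nat \<Rightarrow> complex" where
  "coeff2 f i j = coeff (coeff f i) j"

definition eval2 :: "complex poly poly \<Rightarrow> complex \<Rightarrow> complex \<Rightarrow> complex" where
  "eval2 f a b = poly (poly f [:a:]) b"


definition GL2 :: "(complex^2^2) monoid" where
  "GL2 = \<lparr>carrier = {A. invertible A}, mult = (**), one = mat 1\<rparr>"

text \<open>
  The first generator is \<open>(1 + \<i>)/2\<close> times the Hadamard matrix. Its lower right entry is
  sometimes misprinted as \<open>(1 - \<i>)/2\<close>; the determinant would then be \<open>(1 - \<i>)/2\<close>, which is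
  not of absolute value 1, and the generated group would be infinite. With the entry
  \<open>-(1 + \<i>)/2\<close> the group has order 96.
\<close>

definition H1 :: "(complex^2^2) set" where
  "H1 = generate GL2
     {vector [vector [(1 + \<i>) / 2, (1 + \<i>) / 2], vector [(1 + \<i>) / 2, - (1 + \<i>) / 2]],
      vector [vector [1, 0], vector [0, \<i>]]}"

text \<open>The \<open>i\<close>-th coordinate of \<open>\<sigma> \<cdot> (x\<^sub>0, x\<^sub>1)\<^sup>t\<close>; the variable \<open>x\<^sub>0\<close> is coordinate \<open>1 :: 2\<close>.\<close>

definition act_coord :: "complex^2^2 \<Rightarrow> 2 \<Rightarrow> complex poly poly" where
  "act_coord \<sigma> i = const2 (\<sigma> $ i $ 1) * x0 + const2 (\<sigma> $ i $ 2) * x1"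

definition phi :: "nat \<Rightarrow> complex poly poly" where
  "phi l = const2 (1 / of_nat (card H1)) * (\<Sum>\<sigma>\<in>H1. act_coord \<sigma> 1 ^ l)"

definition phi_normalized :: "nat \<Rightarrow> complex poly poly" where
  "phi_normalized l = const2 (1 / coeff2 (phi l) l 0) * phi l"


text \<open>
  In the next three definitions \<open>f\<close> is meant to be homogeneous of degree \<open>n\<close> with coefficient
  of \<open>x\<^sub>0\<^sup>n\<close> equal to 1, and different from \<open>x\<^sub>0\<^sup>n\<close>.
\<close>

definition min_dist :: "nat \<Rightarrow> complex poly poly \<Rightarrow> nat" where
  "min_dist n f = (LEAST i. 1 \<le> i \<and> i \<le> n \<and> coeff2 f (n - i) i \<noteq> 0)"

text \<open>
  The quotient \<open>P(T) / ((1 - T)(1 - qT))\<close> is formed in \<open>\<complex>[[T]]\<close> and then embedded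
  coefficientwise into \<open>\<complex>[x\<^sub>0, x\<^sub>1][[T]]\<close>.
\<close>

definition is_zeta_poly :: "nat \<Rightarrow> real \<Rightarrow> complex poly poly \<Rightarrow> complex poly \<Rightarrow> bool" where
  "is_zeta_poly n q f P \<longleftrightarrow>
     degree P \<le> n - min_dist n f \<and>
     fps_nth
       (Abs_fps (\<lambda>k. const2 (fps_nth
            (fps_of_poly P / ((1 - fps_X) * (1 - fps_const (of_real q) * fps_X))) k))
        * (fps_const x0 * fps_X + fps_const x1 * (1 - fps_X)) ^ n)
       (n - min_dist n f)
     = const2 (1 / (of_real q - 1)) * (f - x0 ^ n)"

definition zeta_poly :: "nat \<Rightarrow> real \<Rightarrow> complex poly poly \<Rightarrow> complex poly" where
  "zeta_poly n q f = (THE P. is_zeta_poly n q f P)"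

definition P_phi :: "nat \<Rightarrow> complex poly" where
  "P_phi l = zeta_poly l 2 (phi_normalized l)"


text \<open>
  \<open>interlace_on_circle r P Q\<close>: all zeros of \<open>P\<close> and \<open>Q\<close> lie on \<open>|T| = r\<close>, and strictly inside
  every open arc (including the one wrapping around) between two consecutive zeros of \<open>P\<close> there
  is a zero of \<open>Q\<close>. The relation is directed, \<open>P\<close> being the polynomial with fewer zeros: on a
  circle the condition can hold in both directions only for polynomials with equally many
  distinct zeros, whereas the polynomials compared below have degrees \<open>l - 6\<close> and \<open>l - 2\<close>.
\<close>

definition interlace_on_circle :: "real \<Rightarrow> complex poly \<Rightarrow> complex poly \<Rightarrow> bool" where
  "interlace_on_circle r P Q \<longleftrightarrow>
     (\<forall>z. poly P z = 0 \<longrightarrow> cmod z = r) \<and>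
     (\<forall>z. poly Q z = 0 \<longrightarrow> cmod z = r) \<and>
     (\<forall>\<alpha> \<beta>. \<alpha> < \<beta> \<and> \<beta> < \<alpha> + 2 * pi \<and>
        poly P (rcis r \<alpha>) = 0 \<and> poly P (rcis r \<beta>) = 0 \<and>
        (\<forall>\<gamma>. \<alpha> < \<gamma> \<and> \<gamma> < \<beta> \<longrightarrow> poly P (rcis r \<gamma>) \<noteq> 0) \<longrightarrow>
        (\<exists>\<gamma>. \<alpha> < \<gamma> \<and> \<gamma> < \<beta> \<and> poly Q (rcis r \<gamma>) = 0))"


text \<open>
  Since \<^term>\<open>multiplicity p 0 = 0\<close>, this gives \<open>padic_val p 0 = 0\<close> instead of \<open>\<infinity>\<close>; only the
  condition \<open>padic_val p a \<ge> 0\<close> is used, for which the difference is immaterial.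
\<close>

definition padic_val :: "nat \<Rightarrow> rat \<Rightarrow> int" where
  "padic_val p a = int (multiplicity (int p) (fst (quotient_of a)))
                 - int (multiplicity (int p) (snd (quotient_of a)))"

definition p_integral :: "nat \<Rightarrow> complex \<Rightarrow> bool" where
  "p_integral p z \<longleftrightarrow> (\<exists>a::rat. z = of_rat a \<and> padic_val p a \<ge> 0)"


definition theta0 :: "complex \<Rightarrow> complex" where
  "theta0 \<tau> = (\<Sum>\<^sub>\<infinity>b\<in>{b::int. b mod 2 = 0}. exp (of_real pi * \<i> * of_int b ^ 2 * \<tau> / 2))"

definition theta1 :: "complex \<Rightarrow> complex" where
  "theta1 \<tau> = (\<Sum>\<^sub>\<infinity>b\<in>{b::int. b mod 2 = 1}. exp (of_real pi * \<i> * of_int b ^ 2 * \<tau> / 2))"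

text \<open>
  \<open>is_Q_expansion F c\<close>: on the upper half plane \<open>F\<close> is the sum of the power series
  with coefficients \<open>c\<close> in \<open>Q = exp(\<pi>\<i>\<tau>/2)\<close>. As \<open>Q\<close> takes every value with \<open>0 < |Q| < 1\<close>,
  the sequence \<open>c\<close> is determined by \<open>F\<close>.
\<close>

definition is_Q_expansion :: "(complex \<Rightarrow> complex) \<Rightarrow> (nat \<Rightarrow> complex) \<Rightarrow> bool" where
  "is_Q_expansion F c \<longleftrightarrow>
     (\<forall>\<tau>. Im \<tau> > 0 \<longrightarrow> (\<lambda>k. c k * exp (of_real pi * \<i> * \<tau> / 2) ^ k) sums F \<tau>)"

end

theory Submission
  imports "HOL-Number_Theory.Residues" Defs
begin

text \<open>
  The group \<open>H1\<close> permutes the \<open>24\<close> row vectors \<open>(a, 0)\<close>, \<open>(0, a)\<close>, \<open>(ha, hb)\<close> with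
  \<open>a\<^sup>4 = b\<^sup>4 = 1\<close> and \<open>h = (1 + \<i>)/2\<close> transitively, so \<open>\<phi>\<^sub>l\<close> is a multiple of the sum of the
  \<open>l\<close>-th powers of the corresponding linear forms. It vanishes unless \<open>l = 4N + 4\<close> with \<open>N \<ge> 1\<close>,
  and then the normalized form has the coefficients \<open>1\<close> at \<open>x\<^sub>0\<^sup>l\<close> and \<open>x\<^sub>1\<^sup>l\<close> and \<open>c (l choose j)\<close>
  at the other \<open>x\<^sub>0\<^sup>l\<^sup>-\<^sup>jx\<^sub>1\<^sup>j\<close> with \<open>4 dvd j\<close>, where \<open>c = 1/(1 - (-4)\<^sup>N)\<close>. From the identity
  \<open>(1 - T)\<^sup>4 - T\<^sup>4 = (1 - 2T)(1 - 2T + 2T\<^sup>2)\<close> one finds the zeta polynomial in closed form: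
  \<open>(1 - 2T + 2T\<^sup>2) P\<^sub>l(T) = c (1 - (-4T\<^sup>4)\<^sup>N)\<close>. Its zeros are the \<open>4N\<close> equally spaced solutions of
  \<open>(-4T\<^sup>4)\<^sup>N = 1\<close> except \<open>(1 \<plusminus> \<i>)/2\<close>; interlacing holds since between two consecutive multiples of
  \<open>1/N\<close> there is a multiple of \<open>1/(N + 1)\<close>, which cannot be an integer. For \<open>l = 2(p - 1)\<close>, Fermat's
  theorem shows that \<open>p\<close> divides \<open>1 - (-4)\<^sup>N\<close> only if it divides \<open>15\<close>.
\<close>

section \<open>Localization of the integers at a prime\<close>

definition p_local :: "nat \<Rightarrow> complex set" where
  "p_local p = {of_int m / of_int n | m n. \<not> int p dvd n}"

lemma p_localI: "z = of_int m / of_int n \<Longrightarrow> \<not> int p dvd n \<Longrightarrow> z \<in> p_local p"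
  unfolding p_local_def by blast

lemma p_local_of_int: "prime p \<Longrightarrow> of_int m \<in> p_local p"
  by (rule p_localI[where n = 1]) (auto simp: not_prime_unit)

lemma p_local_of_nat: "prime p \<Longrightarrow> of_nat m \<in> p_local p"
  using p_local_of_int[of p "int m"] by simp

lemma p_local_add:
  assumes "prime p" "a \<in> p_local p" "b \<in> p_local p"
  shows "a + b \<in> p_local p"
proof -
  obtain m n m' n' where *: "a = of_int m / of_int n" "\<not> int p dvd n"
    "b = of_int m' / of_int n'" "\<not> int p dvd n'"
    using assms(2,3) unfolding p_local_def by blast
  have nz: "n \<noteq> 0" "n' \<noteq> 0"
    using *(2,4) by auto
  show ?thesis
    by (rule p_localI[where m = "m * n' + m' * n" and n = "n * n'"])
      (use nz * \<open>prime p\<close> in \<open>auto simp: field_simps prime_dvd_mult_iff\<close>)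
qed

lemma p_local_mult:
  assumes "prime p" "a \<in> p_local p" "b \<in> p_local p"
  shows "a * b \<in> p_local p"
proof -
  obtain m n m' n' where *: "a = of_int m / of_int n" "\<not> int p dvd n"
    "b = of_int m' / of_int n'" "\<not> int p dvd n'"
    using assms(2,3) unfolding p_local_def by blast
  show ?thesis
    by (rule p_localI[where m = "m * m'" and n = "n * n'"])
      (use * \<open>prime p\<close> in \<open>auto simp: prime_dvd_mult_iff\<close>)
qed

lemma p_local_sum:
  assumes "prime p" "\<And>x. x \<in> A \<Longrightarrow> f x \<in> p_local p"
  shows "sum f A \<in> p_local p"
proof (cases "finite A")
  case True
  then show ?thesis
    using assms(2)
  proof (induction A rule: finite_induct)
    case empty
    then show ?case
      using p_local_of_int[OF assms(1), of 0] by simp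
  qed (auto intro: p_local_add[OF assms(1)])
qed (use p_local_of_int[OF assms(1), of 0] in simp)

text \<open>If r/s is the reduced form of m/n, then m s = r n with r and s coprime, so s divides n.
  Hence p does not divide s, and only a nonnegative term remains in the valuation.\<close>

lemma p_local_p_integral:
  assumes "prime p" "z \<in> p_local p"
  shows "p_integral p z"
proof -
  obtain m n where mn: "z = of_int m / of_int n" "\<not> int p dvd n"
    using assms(2) unfolding p_local_def by blast
  have n0: "n \<noteq> 0"
    using mn(2) by auto
  define a :: rat where "a = of_int m / of_int n"
  obtain r s where rs: "quotient_of a = (r, s)"
    by (cases "quotient_of a")
  have s0: "s > 0" and cop: "coprime r s" and a: "a = of_int r / of_int s"
    using rs quotient_of_denom_pos quotient_of_coprime quotient_of_div by blast+
  have "of_int (m * s) = (of_int (r * n) :: rat)"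
    using a n0 s0 by (simp add: a_def field_simps)
  then have "m * s = r * n"
    using of_int_eq_iff by blast
  then have "s dvd n"
    using cop by (metis coprime_commute coprime_dvd_mult_right_iff dvd_triv_right)
  then have "\<not> int p dvd s"
    using mn(2) dvd_trans by blast
  then have "padic_val p a \<ge> 0"
    by (simp add: padic_val_def rs not_dvd_imp_multiplicity_0)
  moreover have "z = of_rat a"
    by (simp add: mn a_def of_rat_divide)
  ultimately show ?thesis
    unfolding p_integral_def by blast
qed

section \<open>Binary forms\<close>

text \<open>The weight \<open>w j\<close> is the whole coefficient, binomial factor included. Every
  homogeneous polynomial below takes this shape, which turns polynomial identities into identities
  of weights.\<close>

definition form :: "nat \<Rightarrow> (nat \<Rightarrow> complex) \<Rightarrow> complex poly poly" where
  "form l w = (\<Sum>j\<le>l. const2 (w j) * x0 ^ (l - j) * x1 ^ j)"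

lemma const2_add: "const2 (a + b) = const2 a + const2 b"
  and const2_diff: "const2 (a - b) = const2 a - const2 b"
  and const2_mult: "const2 (a * b) = const2 a * const2 b"
  and const2_0: "const2 0 = 0"
  by (simp_all add: const2_def)

lemma const2_1: "const2 1 = 1"
  by (metis const2_def one_pCons)

lemma const2_sum: "const2 (sum f A) = (\<Sum>x\<in>A. const2 (f x))"
  by (induction A rule: infinite_finite_induct) (simp_all add: const2_0 const2_add)

lemma const2_power: "const2 (a ^ n) = const2 a ^ n"
  by (induction n) (simp_all add: const2_1 const2_mult)

lemma const2_of_nat: "const2 (of_nat n) = of_nat n"
  by (induction n) (simp_all add: const2_0 const2_1 const2_add)

lemma monomial_eq_monom: "const2 c * x0 ^ i * x1 ^ j = monom (monom c j) i"
proof -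
  have "x0 ^ i = monom 1 i"
    by (simp only: x0_def monom_altdef smult_1_left)
  moreover have "x1 ^ j = [:monom 1 j:]"
    by (simp only: x1_def monom_altdef smult_1_left poly_const_pow)
  ultimately show ?thesis
    by (simp add: const2_def smult_monom mult.commute)
qed

lemma coeff2_monomial:
  "coeff2 (const2 c * x0 ^ i * x1 ^ j) i' j' = (if i = i' \<and> j = j' then c else 0)"
  by (simp add: coeff2_def monomial_eq_monom)

lemma coeff2_sum: "coeff2 (sum f A) i j = (\<Sum>x\<in>A. coeff2 (f x) i j)"
  by (simp add: coeff2_def coeff_sum)

lemma coeff2_form: "coeff2 (form l w) i j = (if i + j = l then w j else 0)"
proof -
  have "coeff2 (form l w) i j = (\<Sum>k\<le>l. if k = j then (if i + j = l then w j else 0) else 0)"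
    unfolding form_def coeff2_sum coeff2_monomial by (rule sum.cong) auto
  also have "\<dots> = (if i + j = l then w j else 0)"
    by (subst sum.delta) auto
  finally show ?thesis .
qed

lemma form_cong: "(\<And>j. j \<le> l \<Longrightarrow> w j = w' j) \<Longrightarrow> form l w = form l w'"
  by (simp add: form_def)

lemma form_eq_iff: "form l w = form l w' \<longleftrightarrow> (\<forall>j\<le>l. w j = w' j)"
proof
  assume *: "form l w = form l w'"
  show "\<forall>j\<le>l. w j = w' j"
  proof (intro allI impI)
    fix j assume "j \<le> l"
    then show "w j = w' j"
      using arg_cong[OF *, of "\<lambda>f. coeff2 f (l - j) j"] by (simp add: coeff2_form)
  qed
qed (blast intro: form_cong)

lemma form_0: "form l (\<lambda>_. 0) = 0"
  by (simp add: form_def const2_0)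

lemma form_cmult: "const2 c * form l w = form l (\<lambda>j. c * w j)"
  by (simp add: form_def sum_distrib_left const2_mult mult.assoc)

lemma form_sum: "(\<Sum>x\<in>A. form l (w x)) = form l (\<lambda>j. \<Sum>x\<in>A. w x j)"
proof -
  have "(\<Sum>x\<in>A. form l (w x)) = (\<Sum>j\<le>l. \<Sum>x\<in>A. const2 (w x j) * x0 ^ (l - j) * x1 ^ j)"
    unfolding form_def by (rule sum.swap)
  then show ?thesis
    by (simp add: form_def const2_sum sum_distrib_right)
qed

lemma form_diff_x0_power: "form l w - x0 ^ l = form l (\<lambda>j. w j - (if j = 0 then 1 else 0))"
proof -
  have "x0 ^ l = (\<Sum>j\<le>l. if j = 0 then x0 ^ l else 0)"
    by simp
  also have "\<dots> = form l (\<lambda>j. if j = 0 then 1 else 0)"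
    unfolding form_def by (rule sum.cong) (auto simp: const2_1 const2_0)
  finally have "form l w - x0 ^ l = (\<Sum>j\<le>l. const2 (w j) * x0 ^ (l - j) * x1 ^ j
      - const2 (if j = 0 then 1 else 0) * x0 ^ (l - j) * x1 ^ j)"
    by (simp add: form_def sum_subtractf)
  also have "\<dots> = form l (\<lambda>j. w j - (if j = 0 then 1 else 0))"
    unfolding form_def by (rule sum.cong) (auto simp: const2_diff algebra_simps)
  finally show ?thesis .
qed

lemma linear_form_power:
  "(const2 a * x0 + const2 b * x1) ^ l = form l (\<lambda>j. of_nat (l choose j) * a ^ (l - j) * b ^ j)"
proof -
  have "(const2 b * x1 + const2 a * x0) ^ l =
      (\<Sum>j\<le>l. of_nat (l choose j) * (const2 b * x1) ^ j * (const2 a * x0) ^ (l - j))"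
    by (rule binomial_ring)
  then show ?thesis
    by (simp add: form_def const2_mult const2_of_nat const2_power power_mult_distrib
        algebra_simps)
qed

lemma eval2_form: "eval2 (form l w) a b = (\<Sum>j\<le>l. w j * a ^ (l - j) * b ^ j)"
  by (simp add: eval2_def form_def x0_def x1_def const2_def poly_sum)
    (simp add: mult.assoc)

section \<open>The orbit of first rows\<close>

no_notation fps_nth (infixl "$" 75)

lemma group_GL2: "group GL2"
proof (rule groupI)
  fix A B assume "A \<in> carrier GL2" "B \<in> carrier GL2"
  then show "A \<otimes>\<^bsub>GL2\<^esub> B \<in> carrier GL2"
    by (simp add: GL2_def invertible_mult)
next
  fix A assume "A \<in> carrier GL2"
  then obtain B where "A ** B = mat 1" "B ** A = mat 1"
    by (auto simp: GL2_def invertible_def)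
  then show "\<exists>B\<in>carrier GL2. B \<otimes>\<^bsub>GL2\<^esub> A = \<one>\<^bsub>GL2\<^esub>"
    by (auto simp: GL2_def invertible_def)
qed (auto simp: GL2_def matrix_mul_assoc invertible_def intro: exI[of _ "mat 1"])

definition hadamard_gen :: "complex^2^2" where
  "hadamard_gen = vector [vector [(1 + \<i>) / 2, (1 + \<i>) / 2], vector [(1 + \<i>) / 2, - (1 + \<i>) / 2]]"

definition diag_gen :: "complex^2^2" where
  "diag_gen = vector [vector [1, 0], vector [0, \<i>]]"

lemma H1_eq: "H1 = generate GL2 {hadamard_gen, diag_gen}"
  by (simp add: H1_def hadamard_gen_def diag_gen_def)

definition units4 :: "complex set" where
  "units4 = {1, \<i>, - 1, - \<i>}"

definition hada :: complex where
  "hada = (1 + \<i>) / 2"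

definition rows :: "(complex^2) set" where
  "rows = (\<lambda>a. vector [a, 0]) ` units4 \<union> (\<lambda>a. vector [0, a]) ` units4
     \<union> (\<lambda>(a, b). vector [hada * a, hada * b]) ` (units4 \<times> units4)"

lemma vec2_eq_iff: "(v :: complex^2) = w \<longleftrightarrow> v $ 1 = w $ 1 \<and> v $ 2 = w $ 2"
  by (simp add: vec_eq_iff forall_2)

lemma vec2_mult_hadamard: "vector [a, b] v* hadamard_gen = vector [hada * (a + b), hada * (a - b)]"
  by (simp add: vec2_eq_iff vector_matrix_mult_def hadamard_gen_def sum_2 hada_def algebra_simps)
    (simp add: field_simps)

lemma vec2_mult_diag: "vector [a, b] v* diag_gen = vector [a, \<i> * b]"
  by (simp add: vec2_eq_iff vector_matrix_mult_def diag_gen_def sum_2)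

lemma units4_1: "1 \<in> units4"
  by (simp add: units4_def)

lemma units4_i_mult: "a \<in> units4 \<Longrightarrow> \<i> * a \<in> units4"
  and units4_uminus: "a \<in> units4 \<Longrightarrow> - a \<in> units4"
  by (auto simp: units4_def)

text \<open>The quotient b/a is again a fourth root of unity. Its value decides what the Hadamard
  generator does to a row (ha, hb).\<close>

lemma units4_cases:
  assumes "a \<in> units4" "b \<in> units4"
  obtains "b = a" | "b = - a" | "b = \<i> * a" | "b = - (\<i> * a)"
  using assms by (auto simp: units4_def)

lemma rows_memI:
  "a \<in> units4 \<Longrightarrow> vector [a, 0] \<in> rows"
  "a \<in> units4 \<Longrightarrow> vector [0, a] \<in> rows"
  "a \<in> units4 \<Longrightarrow> b \<in> units4 \<Longrightarrow> vector [hada * a, hada * b] \<in> rows"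
  by (auto simp: rows_def)

lemma rowsE:
  assumes "v \<in> rows"
  obtains a where "a \<in> units4" "v = vector [a, 0]"
  | a where "a \<in> units4" "v = vector [0, a]"
  | a b where "a \<in> units4" "b \<in> units4" "v = vector [hada * a, hada * b]"
  using assms by (auto simp: rows_def)

lemma finite_rows: "finite rows"
  by (simp add: rows_def units4_def)

lemma rows_mult_diag:
  assumes "v \<in> rows"
  shows "v v* diag_gen \<in> rows"
  using assms
proof (cases rule: rowsE)
  case (3 a b)
  then show ?thesis
    using rows_memI(3)[of a "\<i> * b"] by (simp add: vec2_mult_diag units4_i_mult mult.left_commute)
qed (simp_all add: vec2_mult_diag rows_memI units4_i_mult)

lemma rows_mult_hadamard:
  assumes "v \<in> rows"
  shows "v v* hadamard_gen \<in> rows"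
  using assms
proof (cases rule: rowsE)
  case (3 a b)
  \<comment> \<open>The factor is the square of \<open>hada\<close>. For b = a or b = -a one
    coordinate vanishes; for the other two values of b both coordinates are \<open>hada\<close>
    times a unit.\<close>
  have v: "v v* hadamard_gen = vector [\<i> / 2 * (a + b), \<i> / 2 * (a - b)]"
    by (simp add: 3 vec2_mult_hadamard vec2_eq_iff hada_def field_simps)
  from 3(1,2) show ?thesis
  proof (cases rule: units4_cases)
    case 1
    then have "v v* hadamard_gen = vector [\<i> * a, 0]"
      by (simp add: v vec2_eq_iff)
    then show ?thesis
      using 3 by (simp add: rows_memI units4_i_mult)
  next
    case 2
    then have "v v* hadamard_gen = vector [0, \<i> * a]"
      by (simp add: v vec2_eq_iff)
    then show ?thesis
      using 3 by (simp add: rows_memI units4_i_mult)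
  next
    case 3
    then have "v v* hadamard_gen = vector [hada * (\<i> * a), hada * a]"
      by (simp add: v vec2_eq_iff hada_def field_simps)
    then show ?thesis
      using \<open>a \<in> units4\<close> by (simp only: rows_memI units4_i_mult)
  next
    case 4
    then have "v v* hadamard_gen = vector [hada * a, hada * (\<i> * a)]"
      by (simp add: v vec2_eq_iff hada_def field_simps)
    then show ?thesis
      using \<open>a \<in> units4\<close> by (simp only: rows_memI units4_i_mult)
  qed
next
  case (1 a)
  then show ?thesis
    using rows_memI(3)[of a a] by (simp add: vec2_mult_hadamard)
next
  case (2 a)
  then show ?thesis
    using rows_memI(3)[of a "- a"] by (simp add: vec2_mult_hadamard units4_uminus)
qed

section \<open>The group \<open>H1\<close> and its right action on the rows\<close>

lemma invertible_gens: "invertible hadamard_gen" "invertible diag_gen"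
  by (simp_all add: invertible_det_nz det_2 hadamard_gen_def diag_gen_def complex_eq_iff)

lemma H1_subgroup: "subgroup H1 GL2"
  unfolding H1_eq
  by (rule group.generate_is_subgroup[OF group_GL2])
    (simp add: GL2_def invertible_gens)

lemma H1_mult: "\<sigma> \<in> H1 \<Longrightarrow> \<tau> \<in> H1 \<Longrightarrow> \<sigma> ** \<tau> \<in> H1"
  using subgroup.m_closed[OF H1_subgroup] by (simp add: GL2_def)

lemma H1_one: "mat 1 \<in> H1"
  using subgroup.one_closed[OF H1_subgroup] by (simp add: GL2_def)

lemma H1_inverse:
  assumes "\<sigma> \<in> H1"
  obtains \<tau> where "\<tau> \<in> H1" "\<sigma> ** \<tau> = mat 1" "\<tau> ** \<sigma> = mat 1"
proof
  have \<sigma>: "\<sigma> \<in> carrier GL2"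
    using subgroup.mem_carrier[OF H1_subgroup assms] .
  show "inv\<^bsub>GL2\<^esub> \<sigma> \<in> H1"
    using subgroup.m_inv_closed[OF H1_subgroup assms] .
  show "\<sigma> ** inv\<^bsub>GL2\<^esub> \<sigma> = mat 1" "inv\<^bsub>GL2\<^esub> \<sigma> ** \<sigma> = mat 1"
    using group.r_inv[OF group_GL2 \<sigma>] group.l_inv[OF group_GL2 \<sigma>] by (simp_all add: GL2_def)
qed

lemma H1_gens: "hadamard_gen \<in> H1" "diag_gen \<in> H1"
  unfolding H1_eq by (simp_all add: generate.incl)

text \<open>A generator permutes the finite set of rows, hence so does its inverse.\<close>

lemma rows_mult_inverse:
  assumes "\<And>v. v \<in> rows \<Longrightarrow> v v* \<sigma> \<in> rows" "\<sigma> ** \<tau> = mat 1" "v \<in> rows"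
  shows "v v* \<tau> \<in> rows"
proof -
  have inv: "(w v* \<sigma>) v* \<tau> = w" for w
    by (simp add: vector_matrix_mul_assoc assms(2))
  have "inj_on (\<lambda>w. w v* \<sigma>) rows"
    by (rule inj_on_inverseI[where g = "\<lambda>w. w v* \<tau>"]) (rule inv)
  then have "(\<lambda>w. w v* \<sigma>) ` rows = rows"
    by (intro endo_inj_surj) (auto simp: finite_rows assms(1))
  then obtain w where "w \<in> rows" "v = w v* \<sigma>"
    using assms(3) by blast
  then show ?thesis
    by (simp add: inv)
qed

lemma rows_mult_H1:
  assumes "\<sigma> \<in> H1" "v \<in> rows"
  shows "v v* \<sigma> \<in> rows"
proof -
  have gen: "w v* h \<in> rows" if "h \<in> {hadamard_gen, diag_gen}" "w \<in> rows" for h w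
    using that by (auto simp: rows_mult_diag rows_mult_hadamard)
  show ?thesis
    using assms unfolding H1_eq
  proof (induction arbitrary: v rule: generate.induct)
    case one
    then show ?case
      by (simp add: GL2_def)
  next
    case (incl h)
    then show ?case
      by (rule gen)
  next
    case (inv h)
    have "h \<in> carrier GL2"
      using inv.hyps by (auto simp: GL2_def invertible_gens)
    then have "h ** inv\<^bsub>GL2\<^esub> h = mat 1"
      using group.r_inv[OF group_GL2] by (simp add: GL2_def)
    then show ?case
      using rows_mult_inverse gen inv by blast
  next
    case (eng h1 h2)
    then show ?case
      by (simp add: GL2_def vector_matrix_mul_assoc[symmetric])
  qed
qed

lemma row1_eq: "\<sigma> $ 1 = vector [1, 0] v* (\<sigma> :: complex^2^2)"
  and row2_eq: "\<sigma> $ 2 = vector [0, 1] v* (\<sigma> :: complex^2^2)"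
  by (simp_all add: vec2_eq_iff vector_matrix_mult_def sum_2)

lemma row1_mult: "((\<sigma> :: complex^2^2) ** \<tau>) $ 1 = \<sigma> $ 1 v* (\<tau> :: complex^2^2)"
  by (simp add: row1_eq vector_matrix_mul_assoc)

lemma row1_in_rows: "\<sigma> \<in> H1 \<Longrightarrow> \<sigma> $ 1 \<in> rows"
  unfolding row1_eq by (rule rows_mult_H1) (auto intro: rows_memI units4_1)

lemma row2_in_rows: "\<sigma> \<in> H1 \<Longrightarrow> \<sigma> $ 2 \<in> rows"
  unfolding row2_eq by (rule rows_mult_H1) (auto intro: rows_memI units4_1)

text \<open>A matrix is determined by its two rows, and both lie in the finite set
  \<open>rows\<close>, being the images of (1, 0) and (0, 1).\<close>

lemma finite_H1: "finite H1"
proof -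
  have "inj_on (\<lambda>\<sigma> :: complex^2^2. (\<sigma> $ 1, \<sigma> $ 2)) H1"
    by (auto simp: inj_on_def vec_eq_iff forall_2)
  moreover have "(\<lambda>\<sigma> :: complex^2^2. (\<sigma> $ 1, \<sigma> $ 2)) ` H1 \<subseteq> rows \<times> rows"
    using row1_in_rows row2_in_rows by auto
  ultimately show ?thesis
    using finite_rows by (meson finite_SigmaI inj_on_finite)
qed

lemma card_H1: "card H1 > 0"
  using finite_H1 H1_one by (auto simp: card_gt_0_iff)

text \<open>Starting from (1, 0), the Hadamard generator leads to (h, h), powers of the diagonal
  generator to all (h, hb), and a second Hadamard step back to the axes with an extra factor \<i>.
  Iterating reaches every row.\<close>

lemma rows_transitive:
  assumes "r \<in> rows"
  obtains \<sigma> :: "complex^2^2" where "\<sigma> \<in> H1" "\<sigma> $ 1 = r"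
proof -
  define R where "R = (\<lambda>\<sigma> :: complex^2^2. \<sigma> $ 1) ` H1"
  have diag: "vector [a, \<i> * b] \<in> R" if mem: "vector [a, b] \<in> R" for a b
  proof -
    obtain \<sigma> :: "complex^2^2" where "\<sigma> \<in> H1" "\<sigma> $ 1 = vector [a, b]"
      using mem unfolding R_def image_iff by metis
    then have "(\<sigma> ** diag_gen) $ 1 = vector [a, \<i> * b]" "\<sigma> ** diag_gen \<in> H1"
      by (simp_all add: row1_mult vec2_mult_diag H1_mult H1_gens)
    then show ?thesis
      unfolding R_def by (metis image_eqI)
  qed
  have hada: "vector [hada * (a + b), hada * (a - b)] \<in> R" if mem: "vector [a, b] \<in> R" for a b
  proof -
    obtain \<sigma> :: "complex^2^2" where "\<sigma> \<in> H1" "\<sigma> $ 1 = vector [a, b]"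
      using mem unfolding R_def image_iff by metis
    then have "(\<sigma> ** hadamard_gen) $ 1 = vector [hada * (a + b), hada * (a - b)]"
        "\<sigma> ** hadamard_gen \<in> H1"
      by (simp_all add: row1_mult vec2_mult_hadamard H1_mult H1_gens)
    then show ?thesis
      unfolding R_def by (metis image_eqI)
  qed
  have 0: "vector [1, 0] \<in> R"
    unfolding R_def by (rule image_eqI[OF _ H1_one]) (simp add: row1_eq)
  have full: "vector [hada * a, hada * b] \<in> R"
    if "vector [a, 0] \<in> R" "a \<in> units4" "b \<in> units4" for a b
  proof -
    have 1: "vector [hada * a, hada * a] \<in> R"
      using hada[OF that(1)] by simp
    note 2 = diag[OF 1] note 3 = diag[OF 2] note 4 = diag[OF 3]
    from that(2,3) show ?thesis
      by (cases rule: units4_cases) (use 1 2 3 4 in \<open>simp_all add: mult.left_commute\<close>)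
  qed
  \<comment> \<open>The Hadamard generator is applied to (ha, ha) and to (ha, -ha); the new entry is
    2 h^2 a, and 2 h^2 = \<i>.\<close>
  have unit: "vector [\<i> * a, 0] \<in> R" "vector [0, \<i> * a] \<in> R"
    if "vector [a, 0] \<in> R" "a \<in> units4" for a
    using hada[OF full[OF that that(2)]] hada[OF full[OF that units4_uminus[OF that(2)]]]
    by (simp_all add: hada_def field_simps)
  have 1: "vector [\<i>, 0] \<in> R"
    using unit(1)[OF 0] by (simp add: units4_def)
  have 2: "vector [- 1, 0] \<in> R"
    using unit(1)[OF 1] by (simp add: units4_def)
  have 3: "vector [- \<i>, 0] \<in> R"
    using unit(1)[OF 2] by (simp add: units4_def)
  have left: "vector [a, 0] \<in> R" if "a \<in> units4" for a
    using that 0 1 2 3 by (auto simp: units4_def)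
  have right: "vector [0, a] \<in> R" if "a \<in> units4" for a
    \<comment> \<open>The argument is chosen so that the further factor \<i> from
      \<open>unit\<close> restores a.\<close>
    using unit(2)[OF left[of "\<i> * (- a)"]] that by (simp add: units4_i_mult units4_uminus)
  from assms have "r \<in> R"
    by (cases rule: rowsE) (auto intro: left right full)
  then show ?thesis
    using that unfolding R_def by blast
qed

text \<open>The fibres of \<open>\<sigma> \<mapsto> \<sigma> $ 1\<close> on \<open>H1\<close> are cosets of the stabilizer of \<open>(1, 0)\<close>.\<close>

lemma sum_H1_row1:
  obtains s :: nat where "s > 0"
    "\<And>g :: complex^2 \<Rightarrow> complex poly poly. (\<Sum>\<sigma>\<in>H1. g (\<sigma> $ 1)) = of_nat s * (\<Sum>r\<in>rows. g r)"
proof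
  define F where "F r = {\<sigma> \<in> H1. \<sigma> $ 1 = r}" for r
  let ?e = "vector [1, 0] :: complex^2"
  show "card (F ?e) > 0"
    using finite_H1 H1_one by (auto simp: card_gt_0_iff F_def row1_eq)
  have card_F: "card (F r) = card (F ?e)" if r: "r \<in> rows" for r
  proof -
    obtain \<sigma> :: "complex^2^2" where \<sigma>: "\<sigma> \<in> H1" "\<sigma> $ 1 = r"
      using rows_transitive[OF r] .
    obtain \<tau> where \<tau>: "\<tau> \<in> H1" "\<sigma> ** \<tau> = mat 1" "\<tau> ** \<sigma> = mat 1"
      using H1_inverse[OF \<sigma>(1)] .
    have e: "r v* \<tau> = ?e"
      using \<sigma>(2) \<tau>(2) by (metis row1_eq vector_matrix_mul_assoc vector_matrix_mul_rid)
    \<comment> \<open>Right multiplication by \<tau> acts on first rows and sends r to (1, 0); right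
      multiplication by \<sigma> undoes it.\<close>
    have "bij_betw (\<lambda>\<rho>. \<rho> ** \<tau>) (F r) (F ?e)"
      by (rule bij_betw_byWitness[where f' = "\<lambda>\<rho>. \<rho> ** \<sigma>"])
        (use \<sigma> \<tau> e in \<open>auto simp: F_def H1_mult row1_mult matrix_mul_assoc[symmetric]
            simp flip: row1_eq\<close>)
    then show ?thesis
      by (rule bij_betw_same_card)
  qed
  fix g :: "complex^2 \<Rightarrow> complex poly poly"
  have "(\<Sum>\<sigma>\<in>H1. g (\<sigma> $ 1)) = (\<Sum>r\<in>rows. \<Sum>\<sigma>\<in>F r. g (\<sigma> $ 1))"
    unfolding F_def
    by (rule sum.group[symmetric]) (auto simp: finite_H1 finite_rows row1_in_rows)
  also have "\<dots> = (\<Sum>r\<in>rows. of_nat (card (F r)) * g r)"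
    by (intro sum.cong refl) (simp add: F_def)
  also have "\<dots> = of_nat (card (F ?e)) * (\<Sum>r\<in>rows. g r)"
    by (simp add: sum_distrib_left card_F)
  finally show "(\<Sum>\<sigma>\<in>H1. g (\<sigma> $ 1)) = of_nat (card (F ?e)) * (\<Sum>r\<in>rows. g r)" .
qed

text \<open>The constant is the order of the stabilizer of (1, 0) divided by the order of
  \<open>H1\<close>. It is the same for all l and cancels in the normalization, so neither order has
  to be computed.\<close>

lemma phi_eq_sum_rows:
  obtains \<kappa> where "\<kappa> \<noteq> 0"
    "\<And>l. phi l = const2 \<kappa> * (\<Sum>r\<in>rows. (const2 (r $ 1) * x0 + const2 (r $ 2) * x1) ^ l)"
proof -
  obtain s where s: "s > 0"
    "\<And>g :: complex^2 \<Rightarrow> complex poly poly. (\<Sum>\<sigma>\<in>H1. g (\<sigma> $ 1)) = of_nat s * (\<Sum>r\<in>rows. g r)"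
    using sum_H1_row1 by blast
  show ?thesis
  proof (rule that[of "1 / of_nat (card H1) * of_nat s"])
    show "1 / of_nat (card H1) * of_nat s \<noteq> (0 :: complex)"
      using s(1) card_H1 by simp
    fix l
    show "phi l = const2 (1 / of_nat (card H1) * of_nat s) *
        (\<Sum>r\<in>rows. (const2 (r $ 1) * x0 + const2 (r $ 2) * x1) ^ l)"
      using s(2)[of "\<lambda>r. (const2 (r $ 1) * x0 + const2 (r $ 2) * x1) ^ l"]
      by (simp only: phi_def act_coord_def const2_mult const2_of_nat mult.assoc)
  qed
qed

section \<open>The Eisenstein polynomials\<close>

lemma sum_units4_power: "(\<Sum>a\<in>units4. a ^ j) = (if 4 dvd j then 4 else 0)"
proof -
  have "\<i> \<noteq> 1" "\<i> \<noteq> -1" "-\<i> \<noteq> 1" "- \<i> \<noteq> - 1" "\<i> \<noteq> - \<i>" "- \<i> \<noteq> \<i>"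
    by (simp_all add: complex_eq_iff)
  then have sum: "(\<Sum>a\<in>units4. a ^ j) = 1 + \<i> ^ j + (- 1) ^ j + (- \<i>) ^ j"
    by (simp add: units4_def)
  have red: "a ^ j = a ^ (j mod 4)" if "a ^ 4 = 1" for a :: complex
    using that by (metis mod_div_mult_eq mult.commute mult.right_neutral power_add power_mult power_one)
  have "(\<Sum>a\<in>units4. a ^ j) = 1 + \<i> ^ (j mod 4) + (- 1) ^ (j mod 4) + (- \<i>) ^ (j mod 4)"
    unfolding sum using red[of \<i>] red[of "- 1"] red[of "- \<i>"] by (simp add: power4_eq_xxxx)
  also have "\<dots> = (if j mod 4 = 0 then 4 else 0)"
  proof -
    have "j mod 4 \<in> {0, 1, 2, 3}"
      by auto
    then show ?thesis
      by (auto simp: power3_eq_cube)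
  qed
  finally show ?thesis
    by (simp add: mod_eq_0_iff_dvd)
qed

lemma sum_rows:
  fixes g :: "complex^2 \<Rightarrow> complex"
  shows "(\<Sum>r\<in>rows. g r) = (\<Sum>a\<in>units4. g (vector [a, 0])) + (\<Sum>a\<in>units4. g (vector [0, a]))
    + (\<Sum>a\<in>units4. \<Sum>b\<in>units4. g (vector [hada * a, hada * b]))"
proof -
  have nz: "a \<noteq> 0" if "a \<in> units4" for a
    using that by (auto simp: units4_def)
  have fin: "finite units4"
    by (simp add: units4_def)
  have h: "hada \<noteq> 0"
    by (simp add: hada_def complex_eq_iff)
  have "(\<Sum>r\<in>rows. g r) = (\<Sum>r\<in>(\<lambda>a. vector [a, 0]) ` units4. g r)
      + (\<Sum>r\<in>(\<lambda>a. vector [0, a]) ` units4. g r)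
      + (\<Sum>r\<in>(\<lambda>(a, b). vector [hada * a, hada * b]) ` (units4 \<times> units4). g r)"
    unfolding rows_def
    by (subst sum.union_disjoint; (subst sum.union_disjoint)?)
      (use nz h fin in \<open>auto simp: vec2_eq_iff\<close>)
  also have "\<dots> = (\<Sum>a\<in>units4. g (vector [a, 0])) + (\<Sum>a\<in>units4. g (vector [0, a]))
    + (\<Sum>(a, b)\<in>units4 \<times> units4. g (vector [hada * a, hada * b]))"
    by (subst (1 2 3) sum.reindex)
      (use h in \<open>auto simp: inj_on_def vec2_eq_iff case_prod_beta\<close>)
  finally show ?thesis
    by (simp add: sum.cartesian_product)
qed

text \<open>With 0^0 = 1, the factors \<open>0 ^ j\<close> and \<open>0 ^ m\<close> act as
  indicators: the rows on an axis contribute only to pure powers. The 16 remaining rows give a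
  product of two sums over the fourth roots of unity.\<close>

lemma sum_rows_power:
  "(\<Sum>r\<in>rows. (r $ 1) ^ m * (r $ 2) ^ j) =
    (if 4 dvd m \<and> 4 dvd j then 4 * 0 ^ j + 4 * 0 ^ m + 16 * hada ^ (m + j) else 0)"
proof -
  have "(\<Sum>a\<in>units4. \<Sum>b\<in>units4. (hada * a) ^ m * (hada * b) ^ j)
      = hada ^ (m + j) * (\<Sum>a\<in>units4. a ^ m) * (\<Sum>b\<in>units4. b ^ j)"
    by (simp add: power_mult_distrib power_add sum_distrib_left sum_distrib_right algebra_simps)
  then have "(\<Sum>r\<in>rows. (r $ 1) ^ m * (r $ 2) ^ j) =
      (\<Sum>a\<in>units4. a ^ m) * 0 ^ j + 0 ^ m * (\<Sum>a\<in>units4. a ^ j)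
      + hada ^ (m + j) * (\<Sum>a\<in>units4. a ^ m) * (\<Sum>b\<in>units4. b ^ j)"
    unfolding sum_rows by (simp add: sum_distrib_left sum_distrib_right)
  then show ?thesis
    by (auto simp: sum_units4_power power_0_left)
qed

lemma phi_eq_form:
  obtains \<kappa> where "\<kappa> \<noteq> 0"
    "\<And>l. phi l = form l (\<lambda>j. \<kappa> * (of_nat (l choose j) *
      (if 4 dvd l - j \<and> 4 dvd j then 4 * 0 ^ j + 4 * 0 ^ (l - j) + 16 * hada ^ l else 0)))"
proof -
  obtain \<kappa> where \<kappa>: "\<kappa> \<noteq> 0"
    "\<And>l. phi l = const2 \<kappa> * (\<Sum>r\<in>rows. (const2 (r $ 1) * x0 + const2 (r $ 2) * x1) ^ l)"
    using phi_eq_sum_rows by blast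
  show ?thesis
  proof (rule that[OF \<kappa>(1)])
    fix l
    have "phi l = form l (\<lambda>j. \<kappa> * (\<Sum>r\<in>rows. of_nat (l choose j) * (r $ 1) ^ (l - j) * (r $ 2) ^ j))"
      by (simp only: \<kappa>(2) linear_form_power form_sum form_cmult)
    also have "\<dots> = form l (\<lambda>j. \<kappa> * (of_nat (l choose j) *
      (if 4 dvd l - j \<and> 4 dvd j then 4 * 0 ^ j + 4 * 0 ^ (l - j) + 16 * hada ^ l else 0)))"
    proof (rule form_cong)
      fix j assume "j \<le> l"
      then show "\<kappa> * (\<Sum>r\<in>rows. of_nat (l choose j) * (r $ 1) ^ (l - j) * (r $ 2) ^ j) =
        \<kappa> * (of_nat (l choose j) *
        (if 4 dvd l - j \<and> 4 dvd j then 4 * 0 ^ j + 4 * 0 ^ (l - j) + 16 * hada ^ l else 0))"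
        using sum_rows_power[of "l - j" j] by (simp add: sum_distrib_left mult.assoc flip: sum_distrib_left)
    qed
    finally show "phi l = \<dots>" .
  qed
qed

lemma hada_power: "hada ^ (4 * n) = (- 1 / 4) ^ n"
proof -
  have "hada ^ 4 = - 1 / 4"
    by (simp add: hada_def power4_eq_xxxx field_simps)
  then show ?thesis
    by (simp only: power_mult)
qed

lemma phi_nonzero_imp:
  assumes "l > 0" "phi l \<noteq> 0"
  obtains N where "N \<ge> 1" "l = 4 * N + 4"
proof -
  obtain \<kappa> where \<kappa>: "\<And>l. phi l = form l (\<lambda>j. \<kappa> * (of_nat (l choose j) *
      (if 4 dvd l - j \<and> 4 dvd j then 4 * 0 ^ j + 4 * 0 ^ (l - j) + 16 * hada ^ l else 0)))"
    using phi_eq_form by blast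
  have "\<exists>j\<le>l. 4 dvd l - j \<and> 4 dvd j \<and> 4 * 0 ^ j + 4 * 0 ^ (l - j) + 16 * hada ^ l \<noteq> 0"
  proof (rule ccontr)
    assume *: "\<not> ?thesis"
    have "phi l = form l (\<lambda>_. 0)"
      unfolding \<kappa> by (rule form_cong) (use * in auto)
    then show False
      using assms(2) by (simp add: form_0)
  qed
  then obtain j where j: "j \<le> l" "4 dvd l - j" "4 dvd j"
    "4 * 0 ^ j + 4 * 0 ^ (l - j) + 16 * hada ^ l \<noteq> 0"
    by blast
  have "4 dvd l"
    using j by (metis dvd_diffD1 dvd_diffD)
  then obtain k where k: "l = 4 * k"
    by blast
  \<comment> \<open>For l = 4 only the pure powers are left, and their coefficient is proportional
    to 4 + 16 (-1/4) = 0.\<close>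
  have "k \<noteq> 1"
  proof
    assume "k = 1"
    then have "j = 0 \<or> j = 4"
      using j k by (auto elim!: dvdE)
    then show False
      using j(4) hada_power[of 1] \<open>k = 1\<close> k by auto
  qed
  then show ?thesis
    using that[of "k - 1"] k assms(1) by simp
qed

text \<open>For l = 4N + 4 and u = (-1/4)^N this is -4u / (4 - 4u), the contribution of the 16 mixed
  rows relative to the leading coefficient. For N = 0 the denominator vanishes.\<close>

definition eis_const :: "nat \<Rightarrow> complex" where
  "eis_const N = 1 / (1 - (- 4) ^ N)"

definition eis_weight :: "nat \<Rightarrow> nat \<Rightarrow> complex" where
  "eis_weight N j = (if \<not> 4 dvd j then 0 else if j = 0 \<or> j = 4 * N + 4 then 1
     else eis_const N * of_nat ((4 * N + 4) choose j))"

lemma minus4_power_neq_1: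
  assumes "N \<ge> 1"
  shows "(- 4 :: complex) ^ N \<noteq> 1"
proof
  assume "(- 4 :: complex) ^ N = 1"
  then have "norm ((- 4 :: complex) ^ N) = 1"
    by simp
  then have "(4 :: real) ^ N = 1"
    by (simp add: norm_power)
  moreover have "(4 :: real) ^ N > 1"
    using assms by (intro one_less_power) auto
  ultimately show False
    by simp
qed

lemma eis_const_nonzero: "N \<ge> 1 \<Longrightarrow> eis_const N \<noteq> 0"
  using minus4_power_neq_1[of N] by (simp add: eis_const_def)

lemma phi_normalized_eq:
  assumes "N \<ge> 1"
  shows "phi_normalized (4 * N + 4) = form (4 * N + 4) (eis_weight N)"
proof -
  let ?l = "4 * N + 4" and ?u = "(- 1 / 4 :: complex) ^ N"
  obtain \<kappa> where \<kappa>: "\<kappa> \<noteq> 0" "\<And>l. phi l = form l (\<lambda>j. \<kappa> * (of_nat (l choose j) *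
      (if 4 dvd l - j \<and> 4 dvd j then 4 * 0 ^ j + 4 * 0 ^ (l - j) + 16 * hada ^ l else 0)))"
    using phi_eq_form by blast
  have u: "?u = 1 / (- 4) ^ N"
  proof -
    have "?u * (- 4) ^ N = ((- 1 / 4) * (- 4)) ^ N"
      by (simp only: power_mult_distrib)
    then show ?thesis
      by (simp add: eq_divide_eq)
  qed
  have hl: "16 * hada ^ ?l = - 4 * ?u"
    using hada_power[of "Suc N"] by (simp add: algebra_simps)
  have nz: "4 - 4 * ?u \<noteq> 0"
    using minus4_power_neq_1[OF assms] unfolding u by (simp add: field_simps)
  have cn: "- 4 * ?u / (4 - 4 * ?u) = eis_const N"
    using minus4_power_neq_1[OF assms] unfolding u by (simp add: eis_const_def field_simps)
  have lead: "coeff2 (phi ?l) ?l 0 = \<kappa> * (4 - 4 * ?u)"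
    by (simp only: \<kappa>(2) coeff2_form hl) simp
  show ?thesis
    unfolding phi_normalized_def lead unfolding \<kappa>(2) form_cmult
  proof (rule form_cong)
    fix j assume j: "j \<le> ?l"
    have dvd: "4 dvd ?l - j \<longleftrightarrow> 4 dvd j"
      using j by presburger
    have "1 / (\<kappa> * (4 - 4 * ?u)) * (\<kappa> * (of_nat (?l choose j) * X)) =
        of_nat (?l choose j) * (X / (4 - 4 * ?u))" for X
      using \<kappa>(1) by simp
    moreover have "of_nat (?l choose j) * ((if 4 dvd ?l - j \<and> 4 dvd j
        then 4 * 0 ^ j + 4 * 0 ^ (?l - j) + 16 * hada ^ ?l else 0) / (4 - 4 * ?u)) = eis_weight N j"
      unfolding hl dvd
      using j nz by (auto simp: eis_weight_def power_0_left simp flip: cn)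
    ultimately show "1 / (\<kappa> * (4 - 4 * ?u)) * (\<kappa> * (of_nat (?l choose j) *
       (if 4 dvd ?l - j \<and> 4 dvd j then 4 * 0 ^ j + 4 * 0 ^ (?l - j) + 16 * hada ^ ?l else 0)))
       = eis_weight N j"
      by simp
  qed
qed

lemma min_dist_eis_weight:
  assumes "N \<ge> 1"
  shows "min_dist (4 * N + 4) (form (4 * N + 4) (eis_weight N)) = 4"
  unfolding min_dist_def
proof (rule Least_equality)
  have "eis_weight N 4 \<noteq> 0"
    using assms eis_const_nonzero[OF assms] by (simp add: eis_weight_def binomial_eq_0_iff)
  then show "1 \<le> (4::nat) \<and> 4 \<le> 4 * N + 4 \<and>
      coeff2 (form (4 * N + 4) (eis_weight N)) (4 * N + 4 - 4) 4 \<noteq> 0"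
    by (simp add: coeff2_form)
next
  fix i assume *: "1 \<le> i \<and> i \<le> 4 * N + 4 \<and>
      coeff2 (form (4 * N + 4) (eis_weight N)) (4 * N + 4 - i) i \<noteq> 0"
  then have "4 dvd i"
    by (auto simp: coeff2_form eis_weight_def split: if_splits)
  then show "4 \<le> i"
    using * by (auto dest: dvd_imp_le)
qed

section \<open>The zeta polynomials\<close>

text \<open>This names the embedding occurring in \<open>is_zeta_poly\<close>. Since it respects the
  ring operations, computations can be done in the ordinary power series ring.\<close>

definition lift2 :: "complex fps \<Rightarrow> complex poly poly fps" where
  "lift2 R = Abs_fps (\<lambda>k. const2 (fps_nth R k))"

lemma lift2_nth [simp]: "fps_nth (lift2 R) k = const2 (fps_nth R k)"
  by (simp add: lift2_def)

lemma lift2_mult: "lift2 (R * S) = lift2 R * lift2 S"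
  by (rule fps_ext) (simp add: fps_mult_nth const2_sum const2_mult)

lemma lift2_1: "lift2 1 = 1"
  by (rule fps_ext) (simp add: const2_0 const2_1)

lemma lift2_X: "lift2 fps_X = fps_X"
  by (rule fps_ext) (simp add: fps_X_def const2_0 const2_1)

lemma lift2_diff: "lift2 (R - S) = lift2 R - lift2 S"
  by (rule fps_ext) (simp add: const2_diff)

lemma lift2_power: "lift2 (R ^ n) = lift2 R ^ n"
  by (induction n) (simp_all add: lift2_1 lift2_mult)

text \<open>The binomial theorem separates T from the variables \<open>x0\<close> and
  \<open>x1\<close>, leaving one scalar power series for each monomial.\<close>

lemma lift2_mult_power_nth:
  "fps_nth (lift2 R * (fps_const x0 * fps_X + fps_const x1 * (1 - fps_X)) ^ n) m =
    form n (\<lambda>j. of_nat (n choose j) * fps_nth (R * (1 - fps_X) ^ j * fps_X ^ (n - j)) m)"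
proof -
  have "(fps_const x0 * fps_X + fps_const x1 * (1 - fps_X)) ^ n =
      (fps_const x1 * (1 - fps_X) + fps_const x0 * fps_X) ^ n"
    by (simp only: add.commute)
  also have "\<dots> = (\<Sum>j\<le>n. of_nat (n choose j) * (fps_const x1 * (1 - fps_X)) ^ j
      * (fps_const x0 * fps_X) ^ (n - j))"
    by (rule binomial_ring)
  also have "\<dots> = (\<Sum>j\<le>n. fps_const (of_nat (n choose j) * x0 ^ (n - j) * x1 ^ j)
      * lift2 ((1 - fps_X) ^ j * fps_X ^ (n - j)))"
    by (intro sum.cong refl)
      (simp add: power_mult_distrib lift2_mult lift2_power lift2_diff lift2_1 lift2_X
        fps_of_nat[symmetric] fps_const_power[symmetric] fps_const_mult[symmetric]
        del: fps_const_power fps_const_mult)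
  finally have "lift2 R * (fps_const x0 * fps_X + fps_const x1 * (1 - fps_X)) ^ n =
      (\<Sum>j\<le>n. fps_const (of_nat (n choose j) * x0 ^ (n - j) * x1 ^ j)
      * lift2 (R * (1 - fps_X) ^ j * fps_X ^ (n - j)))"
    by (simp add: sum_distrib_left lift2_mult mult_ac)
  then show ?thesis
    by (simp add: fps_sum_nth form_def const2_mult const2_of_nat mult_ac)
qed

abbreviation zeta_quotient :: "complex poly \<Rightarrow> complex fps" where
  "zeta_quotient P \<equiv> fps_of_poly P / ((1 - fps_X) * (1 - fps_const (of_real 2) * fps_X))"

text \<open>Comparing monomials, the factor T^(n-j) shifts the coefficient index from n - d to j -
  d. For q = 2 the factor 1/(q - 1) is 1.\<close>

lemma is_zeta_poly_form_iff:
  assumes "min_dist n (form n w) = d" "d \<le> n"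
  shows "is_zeta_poly n 2 (form n w) P \<longleftrightarrow> degree P \<le> n - d \<and>
    (\<forall>j\<le>n. (if j < d then 0 else
      of_nat (n choose j) * fps_nth (zeta_quotient P * (1 - fps_X) ^ j) (j - d)) =
      w j - (if j = 0 then 1 else 0))"
proof -
  have "fps_nth (zeta_quotient P * (1 - fps_X) ^ j * fps_X ^ (n - j)) (n - d) =
      (if j < d then 0 else fps_nth (zeta_quotient P * (1 - fps_X) ^ j) (j - d))"
    if "j \<le> n" for j
  proof -
    have "n - d < n - j \<longleftrightarrow> j < d"
      using that assms(2) by linarith
    moreover have "n - d - (n - j) = j - d"
      using that assms(2) by linarith
    ultimately show ?thesis
      by (simp only: fps_X_power_mult_right_nth)
  qed
  then have "fps_nth (lift2 (zeta_quotient P)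
      * (fps_const x0 * fps_X + fps_const x1 * (1 - fps_X)) ^ n) (n - d)
    = form n (\<lambda>j. if j < d then 0 else
        of_nat (n choose j) * fps_nth (zeta_quotient P * (1 - fps_X) ^ j) (j - d))"
    unfolding lift2_mult_power_nth by (intro form_cong) simp
  moreover have "const2 (1 / (of_real 2 - 1)) * (form n w - x0 ^ n)
      = form n (\<lambda>j. w j - (if j = 0 then 1 else 0))"
    by (simp add: form_diff_x0_power const2_1)
  ultimately show ?thesis
    unfolding is_zeta_poly_def assms(1) lift2_def[symmetric] by (simp only: form_eq_iff)
qed

section \<open>Uniqueness of the zeta polynomial\<close>

lemma one_minus_X_power_nth_0: "fps_nth ((1 - fps_X :: complex fps) ^ k) 0 = 1"
  by (simp add: fps_nth_power_0)

lemma one_minus_X_power_nth_eq_0: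
  assumes "k < i"
  shows "fps_nth ((1 - fps_X :: complex fps) ^ k) i = 0"
proof -
  have "(1 - fps_X :: complex fps) = fps_of_poly [:1, - 1:]"
    by (simp add: fps_of_poly_pCons)
  then have "fps_nth ((1 - fps_X :: complex fps) ^ k) i = coeff ([:1, - 1:] ^ k) i"
    by (simp only: fps_of_poly_power[symmetric] fps_of_poly_nth)
  moreover have "degree ([:1, - 1 :: complex:] ^ k) \<le> k"
    using degree_power_le[of "[:1, - 1 :: complex:]" k] by simp
  ultimately show ?thesis
    using assms by (simp add: coeff_eq_0)
qed

text \<open>The system is triangular: powers of 1 - T have constant term 1, so the m-th condition
  expresses the m-th coefficient of F through earlier ones.\<close>

lemma fps_eq_0_upto:
  fixes F :: "complex fps"
  assumes "\<And>m. m \<le> M \<Longrightarrow> fps_nth (F * (1 - fps_X) ^ (m + d)) m = 0"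
  shows "m \<le> M \<Longrightarrow> fps_nth F m = 0"
proof (induction m rule: less_induct)
  case (less m)
  have "0 = (\<Sum>i=0..m. fps_nth F i * fps_nth ((1 - fps_X) ^ (m + d)) (m - i))"
    using assms[OF less.prems] by (simp add: fps_mult_nth)
  also have "\<dots> = (\<Sum>i=0..m. if i = m then fps_nth F m else 0)"
    by (rule sum.cong) (use less in \<open>auto simp: one_minus_X_power_nth_0\<close>)
  finally show ?case
    by simp
qed

lemma zeta_quotient_mult:
  "zeta_quotient P * ((1 - fps_X) * (1 - fps_const (of_real 2) * fps_X)) = fps_of_poly P"
proof -
  have "fps_nth ((1 - fps_X) * (1 - fps_const (of_real 2) * fps_X) :: complex fps) 0 \<noteq> 0"
    by simp
  then show ?thesis
    by (simp add: fps_divide_unit mult.assoc inverse_mult_eq_1 del: fps_mult_nth_0)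
qed

text \<open>The binomial factors are nonzero, so the difference of the two quotients vanishes up to
  degree n - d. Multiplying by the denominator keeps this, and the degree bound handles the higher
  coefficients of P - P'.\<close>

lemma zeta_poly_unique:
  assumes "min_dist n (form n w) = d" "d \<le> n"
    "is_zeta_poly n 2 (form n w) P" "is_zeta_poly n 2 (form n w) P'"
  shows "P = P'"
proof -
  note iff = is_zeta_poly_form_iff[OF assms(1,2)]
  define F where "F = zeta_quotient P - zeta_quotient P'"
  have "fps_nth (F * (1 - fps_X) ^ (m + d)) m = 0" if "m \<le> n - d" for m
  proof -
    have m: "m + d \<le> n" "\<not> m + d < d"
      using that assms(2) by auto
    have "of_nat (n choose (m + d)) * fps_nth (zeta_quotient P * (1 - fps_X) ^ (m + d)) m =
        of_nat (n choose (m + d)) * fps_nth (zeta_quotient P' * (1 - fps_X) ^ (m + d)) m"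
      using assms(3,4)[unfolded iff] m by (metis add_diff_cancel_right')
    then have "fps_nth (zeta_quotient P * (1 - fps_X) ^ (m + d)) m =
        fps_nth (zeta_quotient P' * (1 - fps_X) ^ (m + d)) m"
      using m(1) by (simp add: binomial_eq_0_iff)
    then show ?thesis
      by (simp only: F_def left_diff_distrib fps_sub_nth diff_self)
  qed
  then have F0: "fps_nth F m = 0" if "m \<le> n - d" for m
    using fps_eq_0_upto that by blast
  have "fps_of_poly (P - P') = F * ((1 - fps_X) * (1 - fps_const (of_real 2) * fps_X))"
    by (simp only: F_def left_diff_distrib[of "zeta_quotient P"] zeta_quotient_mult fps_of_poly_diff)
  then have "coeff (P - P') m = fps_nth (F * ((1 - fps_X) * (1 - fps_const (of_real 2) * fps_X))) m" for m
    by (metis fps_of_poly_nth)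
  then have "coeff (P - P') m = 0" if "m \<le> n - d" for m
    using that F0 by (simp add: fps_mult_nth[of F])
  moreover have "coeff (P - P') m = 0" if "m > n - d" for m
    using that assms(3,4) by (simp add: iff coeff_eq_0)
  ultimately have "P - P' = 0"
    by (metis leading_coeff_0_iff not_le)
  then show ?thesis
    by simp
qed

text \<open>This carries out the division by 1 - 2T + 2T^2 explicitly: 1 + 4T^4 = (1 - 2T + 2T^2)(1
  + 2T + 2T^2), and the geometric sum is the cofactor of 1 + 4T^4 in 1 - (-4T^4)^N. Apart from
  \<open>eis_const\<close>, all coefficients are visibly integers.\<close>

definition eis_poly :: "nat \<Rightarrow> complex poly" where
  "eis_poly N = smult (eis_const N) ([:1, 2, 2:] * (\<Sum>i<N. [:0, 0, 0, 0, - 4:] ^ i))"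

lemma eis_poly_mult:
  "[:1, - 2, 2:] * eis_poly N = smult (eis_const N) (1 - [:0, 0, 0, 0, - 4:] ^ N)"
proof -
  have "[:1, - 2, 2:] * [:1, 2, 2:] = (1 - [:0, 0, 0, 0, - 4:] :: complex poly)"
    by (simp add: one_pCons)
  then have "[:1, - 2, 2:] * eis_poly N =
      smult (eis_const N) ((1 - [:0, 0, 0, 0, - 4:]) * (\<Sum>i<N. [:0, 0, 0, 0, - 4:] ^ i))"
    by (simp only: eis_poly_def mult_smult_right mult.assoc[symmetric])
  then show ?thesis
    by (simp only: one_diff_power_eq)
qed

lemma degree_eis_poly: "degree (eis_poly N) \<le> 4 * N"
proof (cases "N = 0")
  case False
  have "degree ([:0, 0, 0, 0, - 4 :: complex:] ^ i) \<le> 4 * (N - 1)" if "i < N" for i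
  proof -
    have "degree ([:0, 0, 0, 0, - 4 :: complex:] ^ i) \<le> 4 * i"
      using degree_power_le[of "[:0, 0, 0, 0, - 4 :: complex:]" i] by simp
    then show ?thesis
      using that by simp
  qed
  then have "degree (\<Sum>i<N. [:0, 0, 0, 0, - 4 :: complex:] ^ i) \<le> 4 * (N - 1)"
    by (intro degree_sum_le) auto
  then have "degree ([:1, 2, 2:] * (\<Sum>i<N. [:0, 0, 0, 0, - 4 :: complex:] ^ i)) \<le> 2 + 4 * (N - 1)"
    by (intro order_trans[OF degree_mult_le] add_mono) auto
  then show ?thesis
    unfolding eis_poly_def using False by (intro order_trans[OF degree_smult_le]) simp
qed (simp add: eis_poly_def)

definition quartic_inverse :: "complex fps" where
  "quartic_inverse = inverse ((1 - fps_X) ^ 4 - fps_X ^ 4)"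

lemma quartic_inverse_mult: "((1 - fps_X) ^ 4 - fps_X ^ 4) * quartic_inverse = 1"
  unfolding quartic_inverse_def
  by (rule inverse_mult_eq_1') (simp add: one_minus_X_power_nth_0)

text \<open>
  With \<open>D\<^sub>m = (1 - T)\<^sup>m\<^sup>+\<^sup>3 / ((1 - T)\<^sup>4 - T\<^sup>4)\<close> one has \<open>D\<^sub>m\<^sub>+\<^sub>4 = T\<^sup>4 D\<^sub>m + (1 - T)\<^sup>m\<^sup>+\<^sup>3\<close>, and the last
  term does not reach degree \<open>m + 4\<close>.
\<close>

lemma quartic_inverse_nth:
  "fps_nth ((1 - fps_X) ^ (m + 3) * quartic_inverse) m = (if 4 dvd m then 1 else 0)"
proof (induction m rule: less_induct)
  case (less m)
  show ?case
  proof (cases "m = 0")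
    case True
    then show ?thesis
      by (simp add: quartic_inverse_def one_minus_X_power_nth_0)
  next
    case False
    have m: "m + 3 = (m - 1) + 4"
      using False by simp
    have "(1 - fps_X) ^ 4 * quartic_inverse = 1 + fps_X ^ 4 * quartic_inverse"
      using quartic_inverse_mult by (simp add: algebra_simps)
    moreover have "(1 - fps_X) ^ (m + 3) * quartic_inverse =
        (1 - fps_X) ^ (m - 1) * ((1 - fps_X) ^ 4 * quartic_inverse)"
      by (simp only: m power_add mult.assoc)
    ultimately have "(1 - fps_X) ^ (m + 3) * quartic_inverse =
        (1 - fps_X) ^ (m - 1) + fps_X ^ 4 * ((1 - fps_X) ^ (m - 1) * quartic_inverse)"
      by (simp only: distrib_left mult_1_left mult_1_right mult_ac)
    then have nth: "fps_nth ((1 - fps_X) ^ (m + 3) * quartic_inverse) m =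
        (if m < 4 then 0 else fps_nth ((1 - fps_X) ^ (m - 1) * quartic_inverse) (m - 4))"
      using False by (simp add: one_minus_X_power_nth_eq_0 fps_X_power_mult_nth)
    show ?thesis
    proof (cases "m < 4")
      case True
      then show ?thesis
        using False nth by (auto dest: dvd_imp_le)
    next
      case ge: False
      then have "m - 4 + 3 = m - 1" "4 dvd m - 4 \<longleftrightarrow> 4 dvd m"
        by presburger+
      then show ?thesis
        using less.IH[of "m - 4"] ge nth by simp
    qed
  qed
qed

text \<open>Inserting the quartic times its inverse makes all denominators cancel: 1 - 2T and one
  factor 1 - T clear the zeta quotient, while 1 - 2T + 2T^2 turns \<open>eis_poly\<close> into a
  binomial. What remains is evaluated by \<open>quartic_inverse_nth\<close>.\<close>

lemma zeta_quotient_eis_poly_nth: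
  assumes "m \<le> 4 * N"
  shows "fps_nth (zeta_quotient (eis_poly N) * (1 - fps_X) ^ (m + 4)) m =
    eis_const N * ((if 4 dvd m then 1 else 0) - (if m = 4 * N then (- 4) ^ N else 0))"
proof -
  let ?R = "zeta_quotient (eis_poly N)" and ?X = "fps_X :: complex fps"
  have fac: "(1 - ?X) ^ 4 - ?X ^ 4 = (1 - fps_const (of_real 2) * ?X) * (1 - 2 * ?X + 2 * ?X ^ 2)"
    by (simp add: numeral_fps_const[symmetric] power4_eq_xxxx power2_eq_square algebra_simps)
  have "fps_of_poly ([:1, - 2, 2:] * eis_poly N) =
      fps_of_poly (smult (eis_const N) (1 - [:0, 0, 0, 0, - 4:] ^ N))"
    by (simp only: eis_poly_mult)
  moreover have "fps_of_poly [:1, - 2, 2 :: complex:] = 1 - 2 * ?X + 2 * ?X ^ 2"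
    by (simp add: fps_of_poly_pCons numeral_fps_const power2_eq_square algebra_simps)
  moreover have "fps_of_poly [:0, 0, 0, 0, - 4 :: complex:] = fps_const (- 4) * ?X ^ 4"
    by (simp add: fps_of_poly_pCons power4_eq_xxxx algebra_simps)
  ultimately have P: "(1 - 2 * ?X + 2 * ?X ^ 2) * fps_of_poly (eis_poly N) =
      fps_const (eis_const N) * (1 - fps_const ((- 4) ^ N) * ?X ^ (4 * N))"
    by (simp only: fps_of_poly_mult fps_of_poly_smult fps_of_poly_diff fps_of_poly_power
        fps_of_poly_1 power_mult_distrib power_mult fps_const_power)
  have "?R * (1 - ?X) ^ (m + 4) =
      ?R * (1 - ?X) ^ (m + 4) * (((1 - ?X) ^ 4 - ?X ^ 4) * quartic_inverse)"
    by (simp add: quartic_inverse_mult)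
  also have "\<dots> = (1 - 2 * ?X + 2 * ?X ^ 2) * (?R * ((1 - ?X) * (1 - fps_const (of_real 2) * ?X)))
      * ((1 - ?X) ^ (m + 3) * quartic_inverse)"
    unfolding fac by (simp add: power_add numeral_eq_Suc mult_ac del: of_real_numeral)
  also have "\<dots> = fps_const (eis_const N) * (((1 - ?X) ^ (m + 3) * quartic_inverse)
      - fps_const ((- 4) ^ N) * (?X ^ (4 * N) * ((1 - ?X) ^ (m + 3) * quartic_inverse)))"
    unfolding zeta_quotient_mult P by (simp only: algebra_simps mult_1_left mult_1_right)
  finally have *: "fps_nth (?R * (1 - ?X) ^ (m + 4)) m = eis_const N *
      (fps_nth ((1 - ?X) ^ (m + 3) * quartic_inverse) m
      - (- 4) ^ N * fps_nth (?X ^ (4 * N) * ((1 - ?X) ^ (m + 3) * quartic_inverse)) m)"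
    by (simp only: fps_mult_left_const_nth fps_sub_nth)
  \<comment> \<open>As m is at most 4N, the shifted series contributes at most its constant term,
    which is 1.\<close>
  have "fps_nth (?X ^ (4 * N) * ((1 - ?X) ^ (m + 3) * quartic_inverse)) m = (if m = 4 * N then 1 else 0)"
    using assms by (simp add: fps_X_power_mult_nth one_minus_X_power_nth_0 quartic_inverse_def)
  then show ?thesis
    unfolding * quartic_inverse_nth by simp
qed

lemma P_phi_eq:
  assumes "N \<ge> 1"
  shows "P_phi (4 * N + 4) = eis_poly N"
proof -
  let ?n = "4 * N + 4"
  let ?f = "form ?n (eis_weight N)"
  have "is_zeta_poly ?n 2 ?f (eis_poly N)"
    unfolding is_zeta_poly_form_iff[OF min_dist_eis_weight[OF assms] le_add2]
  proof (intro conjI allI impI)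
    show "degree (eis_poly N) \<le> 4 * N + 4 - 4"
      using degree_eis_poly by simp
    fix j assume j: "j \<le> ?n"
    show "(if j < 4 then 0 else of_nat (?n choose j)
        * fps_nth (zeta_quotient (eis_poly N) * (1 - fps_X) ^ j) (j - 4)) =
      eis_weight N j - (if j = 0 then 1 else 0)"
    proof (cases "j < 4")
      case True
      then show ?thesis
        by (auto simp: eis_weight_def dest: dvd_imp_le)
    next
      case False
      define m where "m = j - 4"
      have m: "j = m + 4" "m \<le> 4 * N"
        using False j by (auto simp: m_def)
      \<comment> \<open>This is the case j = 4N + 4: the correction term at m = 4N produces exactly
        the coefficient 1 of the last monomial.\<close>
      have "eis_const N * (1 - (- 4) ^ N) = 1"
        using minus4_power_neq_1[OF assms] by (simp add: eis_const_def)
      then show ?thesis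
        using zeta_quotient_eis_poly_nth[OF m(2)] by (auto simp: m(1) eis_weight_def)
    qed
  qed
  moreover have "P = eis_poly N" if "is_zeta_poly ?n 2 ?f P" for P
    using zeta_poly_unique[OF min_dist_eis_weight[OF assms] le_add2 that calculation] .
  ultimately show ?thesis
    unfolding P_phi_def zeta_poly_def phi_normalized_eq[OF assms] by (rule the_equality)
qed

section \<open>Zeros and interlacing\<close>

lemma poly_eis_poly_mult:
  "(1 - 2 * z + 2 * z ^ 2) * poly (eis_poly N) z = eis_const N * (1 - (- 4 * z ^ 4) ^ N)"
proof -
  have "poly ([:1, - 2, 2:] * eis_poly N) z =
      poly (smult (eis_const N) (1 - [:0, 0, 0, 0, - 4:] ^ N)) z"
    by (simp only: eis_poly_mult)
  moreover have "poly [:1, - 2, 2:] z = 1 - 2 * z + 2 * z ^ 2"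
    by (simp add: algebra_simps power2_eq_square)
  moreover have "poly [:0, 0, 0, 0, - 4:] z = - 4 * z ^ 4"
    by (simp add: power4_eq_xxxx)
  ultimately show ?thesis
    by (simp only: poly_mult poly_smult poly_diff poly_power poly_1)
qed

lemma eis_poly_zero_imp:
  assumes "N \<ge> 1" "poly (eis_poly N) z = 0"
  shows "(- 4 * z ^ 4) ^ N = 1"
  using poly_eis_poly_mult[of z N] assms eis_const_nonzero[OF assms(1)] by simp

text \<open>All four solutions of -4z^4 = 1 are set aside. Two of them, the zeros of 1 + 2z + 2z^2,
  are zeros of \<open>eis_poly\<close> as well, but interlacing can be shown without them.\<close>

lemma eis_poly_zeroI:
  assumes "(- 4 * z ^ 4) ^ N = 1" "- 4 * z ^ 4 \<noteq> 1"
  shows "poly (eis_poly N) z = 0"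
proof -
  have "(1 - 2 * z + 2 * z ^ 2) * (1 + 2 * z + 2 * z ^ 2) = 1 + 4 * z ^ 4"
    by (simp add: algebra_simps power2_eq_square power4_eq_xxxx)
  moreover have "1 + 4 * z ^ 4 \<noteq> 0"
    using assms(2) by (auto simp: add_eq_0_iff)
  ultimately have "1 - 2 * z + 2 * z ^ 2 \<noteq> 0"
    by auto
  then show ?thesis
    using poly_eis_poly_mult[of z N] assms(1) by auto
qed

lemma inverse_sqrt2_power4: "(1 / sqrt 2) ^ 4 = 1 / 4"
  using real_sqrt_pow2[of 2] by (simp add: power_divide power4_eq_xxxx power2_eq_square mult.assoc)

lemma eis_poly_zero_norm:
  assumes "N \<ge> 1" "poly (eis_poly N) z = 0"
  shows "cmod z = 1 / sqrt 2"
proof -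
  have "cmod (- 4 * z ^ 4) ^ N = 1"
    using arg_cong[OF eis_poly_zero_imp[OF assms], of cmod] unfolding norm_power norm_one .
  then have "cmod (- 4 * z ^ 4) = 1"
    using assms(1) by (intro power_eq_imp_eq_base[where n = N and b = 1]) auto
  then have "cmod z ^ 4 = (1 / sqrt 2) ^ 4"
    unfolding inverse_sqrt2_power4 by (simp add: norm_mult norm_power)
  then show ?thesis
    by (rule power_eq_imp_eq_base) auto
qed

lemma rcis_quartic: "- 4 * rcis (1 / sqrt 2) \<alpha> ^ 4 = cis (4 * \<alpha> + pi)"
proof -
  have "rcis (1 / sqrt 2) \<alpha> ^ 4 = rcis (1 / 4) (4 * \<alpha>)"
    unfolding DeMoivre2 inverse_sqrt2_power4 by simp
  moreover have "cis (4 * \<alpha> + pi) = - cis (4 * \<alpha>)"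
    by (simp flip: cis_mult)
  ultimately show ?thesis
    unfolding rcis_def[of "1 / 4"] by (simp add: mult.commute)
qed

lemma cis_eq_1_iff_int: "cis (2 * pi * x) = 1 \<longleftrightarrow> x \<in> \<int>"
proof
  assume "cis (2 * pi * x) = 1"
  then have "cos (2 * pi * x) = 1"
    by (simp add: complex_eq_iff)
  then obtain n :: int where "2 * pi * x = of_int n * 2 * pi"
    by (auto simp: cos_one_2pi_int)
  then have "x = of_int n"
    by simp
  then show "x \<in> \<int>"
    by simp
next
  assume "x \<in> \<int>"
  then show "cis (2 * pi * x) = 1"
    by (rule cis_multiple_2pi)
qed

text \<open>The angle is measured in quarter turns from the zero \<open>(1 - \<i>) / 2\<close> of \<open>1 - 2T + 2T\<^sup>2\<close>.\<close>

definition angle :: "real \<Rightarrow> real" where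
  "angle t = pi / 2 * t - pi / 4"

text \<open>The offset -pi/4 in \<open>angle\<close> absorbs, after multiplication by 4, the half
  turn caused by the sign of -4. Zeros then correspond to t with N t integral.\<close>

lemma quartic_angle: "- 4 * rcis (1 / sqrt 2) (angle t) ^ 4 = cis (2 * pi * t)"
  by (simp only: rcis_quartic) (simp add: angle_def algebra_simps)

lemma quartic_angle_power: "(- 4 * rcis (1 / sqrt 2) (angle t) ^ 4) ^ N = cis (2 * pi * (of_nat N * t))"
  unfolding quartic_angle Complex.DeMoivre by (simp add: mult_ac)

lemma eis_poly_zero_angle:
  assumes "N \<ge> 1" "poly (eis_poly N) (rcis (1 / sqrt 2) (angle t)) = 0"
  shows "of_nat N * t \<in> \<int>"
  using eis_poly_zero_imp[OF assms] unfolding quartic_angle_power cis_eq_1_iff_int .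

lemma eis_poly_zero_angleI:
  assumes "of_nat N * t \<in> \<int>" "t \<notin> \<int>"
  shows "poly (eis_poly N) (rcis (1 / sqrt 2) (angle t)) = 0"
proof (rule eis_poly_zeroI)
  show "(- 4 * rcis (1 / sqrt 2) (angle t) ^ 4) ^ N = 1"
    unfolding quartic_angle_power cis_eq_1_iff_int by (rule assms(1))
  show "- 4 * rcis (1 / sqrt 2) (angle t) ^ 4 \<noteq> 1"
    unfolding quartic_angle cis_eq_1_iff_int by (rule assms(2))
qed

lemma angle_surj: obtains t where "\<alpha> = angle t"
  by (rule that[of "(\<alpha> + pi / 4) * 2 / pi"]) (simp add: angle_def field_simps)

lemma angle_less_iff: "angle s < angle t \<longleftrightarrow> s < t"
  by (simp add: angle_def)

lemma fraction_between:
  assumes "N \<ge> 1"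
  obtains t where "of_int j / of_nat N < t" "t < (of_int j + 1) / of_nat N"
    "of_nat (N + 1) * t \<in> \<int>" "t \<notin> (\<int> :: real set)"
proof -
  \<comment> \<open>This is the least integer m with m/(N+1) > j/N. Its excess over j/N is at most
    1/(N+1), which is less than 1/N.\<close>
  define m where "m = \<lfloor>of_int j * of_nat (N + 1) / real N\<rfloor> + 1"
  have N: "real N > 0"
    using assms by simp
  have 1: "of_int m > of_int j * of_nat (N + 1) / real N"
    unfolding m_def by linarith
  have 2: "of_int m \<le> of_int j * of_nat (N + 1) / real N + 1"
    unfolding m_def by linarith
  define t where "t = of_int m / real (N + 1)"
  have t1: "of_int j < t * real N"
    using 1 N by (simp add: t_def field_simps)
  have t2: "t * real N < of_int j + 1"
  proof -
    have "of_int m * real N \<le> of_int j * real (N + 1) + real N"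
      using 2 N by (simp add: field_simps)
    then show ?thesis
      by (simp add: t_def field_simps)
  qed
  show ?thesis
  proof (rule that[of t])
    show "of_int j / real N < t" "t < (of_int j + 1) / real N"
      using t1 t2 N by (simp_all add: field_simps)
    show "of_nat (N + 1) * t \<in> \<int>"
      by (simp add: t_def)
    show "t \<notin> \<int>"
    proof
      assume "t \<in> \<int>"
      then obtain k where "t = of_int k"
        by (elim Ints_cases)
      \<comment> \<open>An integral t = k would put the integer kN strictly between j and j +
        1.\<close>
      then have "of_int j < (of_int (k * int N) :: real)" "of_int (k * int N) < (of_int (j + 1) :: real)"
        using t1 t2 by simp_all
      then have "j < k * int N" "k * int N < j + 1"
        unfolding of_int_less_iff by simp_all
      then show False
        by simp
    qed
  qed
qed

lemma eis_poly_interlace: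
  assumes "N \<ge> 1"
  shows "interlace_on_circle (1 / sqrt 2) (eis_poly N) (eis_poly (N + 1))"
  unfolding interlace_on_circle_def
proof (intro conjI allI impI)
  show "cmod z = 1 / sqrt 2" if "poly (eis_poly N) z = 0" for z
    using eis_poly_zero_norm[OF assms that] .
  show "cmod z = 1 / sqrt 2" if "poly (eis_poly (N + 1)) z = 0" for z
    by (rule eis_poly_zero_norm[OF _ that]) simp
  fix \<alpha> \<beta>
  assume *: "\<alpha> < \<beta> \<and> \<beta> < \<alpha> + 2 * pi \<and>
        poly (eis_poly N) (rcis (1 / sqrt 2) \<alpha>) = 0 \<and> poly (eis_poly N) (rcis (1 / sqrt 2) \<beta>) = 0 \<and>
        (\<forall>\<gamma>. \<alpha> < \<gamma> \<and> \<gamma> < \<beta> \<longrightarrow> poly (eis_poly N) (rcis (1 / sqrt 2) \<gamma>) \<noteq> 0)"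
  obtain a where a: "\<alpha> = angle a"
    by (rule angle_surj)
  obtain b where b: "\<beta> = angle b"
    by (rule angle_surj)
  have "of_nat N * a \<in> \<int>" "of_nat N * b \<in> \<int>"
    using * a b eis_poly_zero_angle[OF assms] by blast+
  then obtain j k where jk: "real N * a = of_int j" "real N * b = of_int k"
    by (meson Ints_cases)
  have "a < b"
    using * by (simp add: a b angle_less_iff)
  then have "real N * a < real N * b"
    using assms by simp
  \<comment> \<open>The two zeros have parameters j/N and k/N, so the arc contains the parameters
    from j/N to (j+1)/N, where \<open>fraction_between\<close> yields a zero of the next
    polynomial.\<close>
  then have "j + 1 \<le> k"
    unfolding jk of_int_less_iff by simp
  then have "(of_int j + 1 :: real) \<le> of_int k"
    by (metis of_int_1 of_int_add of_int_le_iff)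
  moreover have "a = of_int j / real N" "b = of_int k / real N"
    using jk assms by (simp_all add: field_simps)
  moreover obtain t where t: "of_int j / of_nat N < t" "t < (of_int j + 1) / of_nat N"
    "of_nat (N + 1) * t \<in> \<int>" "t \<notin> (\<int> :: real set)"
    using fraction_between[OF assms] .
  ultimately have "a < t" "t < b"
    by (simp, smt (verit) divide_right_mono of_nat_0_le_iff)
  then have "\<alpha> < angle t" "angle t < \<beta>"
    by (simp_all add: a b angle_less_iff)
  then show "\<exists>\<gamma>. \<alpha> < \<gamma> \<and> \<gamma> < \<beta> \<and> poly (eis_poly (N + 1)) (rcis (1 / sqrt 2) \<gamma>) = 0"
    using eis_poly_zero_angleI[OF t(3,4)] by blast
qed

section \<open>Integrality\<close>

lemma p_local_fps_mult:
  assumes "prime p" "\<And>k. fps_nth F k \<in> p_local p" "\<And>k. fps_nth G k \<in> p_local p"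
  shows "fps_nth (F * G) k \<in> p_local p"
  unfolding fps_mult_nth using assms by (intro p_local_sum p_local_mult)

lemma p_local_fps_power:
  assumes "prime p" "\<And>k. fps_nth F k \<in> p_local p"
  shows "fps_nth (F ^ n) k \<in> p_local p"
proof (induction n arbitrary: k)
  case 0
  then show ?case
    using p_local_of_int[OF assms(1), of 0] p_local_of_int[OF assms(1), of 1] by simp
next
  case (Suc n)
  then show ?case
    using p_local_fps_mult[OF assms] by simp
qed

lemma prime_ge_5_cases:
  assumes "prime p" "p \<ge> (5 :: nat)"
  obtains N where "N \<ge> 1" "p = 2 * N + 3" "2 * (p - 1) = 4 * N + 4"
proof -
  have "odd p"
    using assms prime_odd_nat by simp
  then obtain M where M: "p = 2 * M + 1"
    by (elim oddE)
  show ?thesis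
    by (rule that[of "M - 1"]) (use M assms(2) in auto)
qed

lemma eis_const_p_local:
  assumes "prime p" "p = 2 * N + 3" "N \<ge> 2"
  shows "eis_const N \<in> p_local p"
proof -
  have "\<not> int p dvd 1 - (- 4) ^ N"
  proof
    assume "int p dvd 1 - (- 4) ^ N"
    then have "int p dvd (1 - (- 4) ^ N) * (1 + (- 4) ^ N)"
      by (rule dvd_mult2)
    moreover have "(1 - (- 4) ^ N) * (1 + (- 4) ^ N) = (1 - 16 ^ N :: int)"
      by (simp add: algebra_simps flip: power_mult_distrib)
    ultimately have 1: "int p dvd 1 - 16 ^ N"
      by simp
    have "\<not> p dvd 4"
      using assms by (auto dest: dvd_imp_le)
    then have "[4 ^ (p - 1) = 1] (mod p)"
      using fermat_theorem[OF assms(1), of 4] by simp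
    then have "[int (4 ^ (p - 1)) = int 1] (mod int p)"
      by (simp only: cong_int_iff)
    moreover have "int (4 ^ (p - 1)) = 16 * 16 ^ N"
    proof -
      have "p - 1 = 2 * (N + 1)"
        using assms(2) by simp
      then show ?thesis
        by (simp add: power_mult)
    qed
    ultimately have 2: "int p dvd 16 * 16 ^ N - 1"
      by (simp add: cong_iff_dvd_diff)
    \<comment> \<open>Since p - 1 = 2(N + 1), Fermat's theorem concerns 16^(N+1), one power beyond
      16^N. This combination eliminates the power and leaves 15.\<close>
    have "int p dvd 16 * (1 - 16 ^ N) + (16 * 16 ^ N - 1)"
      using 1 2 by (intro dvd_add dvd_mult)
    then have "int p dvd int 15"
      by simp
    then have "p dvd 3 * 5"
      unfolding int_dvd_int_iff by simp
    then have "p dvd 3 \<or> p dvd 5"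
      using assms(1) prime_dvd_mult_iff by blast
    then have "p \<le> 5"
      by (auto dest: dvd_imp_le)
    then show False
      using assms by simp
  qed
  then show ?thesis
    by (intro p_localI[where m = 1 and n = "1 - (- 4) ^ N"]) (simp_all add: eis_const_def)
qed

text \<open>For \<open>p = 5\<close> the denominator of \<open>1/5\<close> is cancelled: \<open>x\<^sub>0\<^sup>8 + 14x\<^sub>0\<^sup>4x\<^sub>1\<^sup>4 + x\<^sub>1\<^sup>8\<close>.\<close>

lemma eis_weight_p_local:
  assumes "prime p" "p = 2 * N + 3" "N \<ge> 1"
  shows "eis_weight N j \<in> p_local p"
proof (cases "N = 1")
  case True
  have "eis_weight 1 j \<in> {0, 1, 14}"
  proof (cases "j > 8")
    case False
    then have "j \<in> {0, 1, 2, 3, 4, 5, 6, 7, 8}"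
      by auto
    moreover have "(8 choose 4 :: nat) = 70"
      by (simp add: numeral_eq_Suc)
    ultimately show ?thesis
      by (auto simp: eis_weight_def eis_const_def)
  qed (auto simp: eis_weight_def)
  then show ?thesis
    using p_local_of_nat[OF assms(1), of 0] p_local_of_nat[OF assms(1), of 1]
      p_local_of_nat[OF assms(1), of 14] True by auto
next
  case False
  then have "eis_const N * of_nat n \<in> p_local p" for n
    using assms by (intro p_local_mult eis_const_p_local p_local_of_nat) auto
  then show ?thesis
    using p_local_of_nat[OF assms(1), of 0] p_local_of_nat[OF assms(1), of 1]
    by (simp add: eis_weight_def)
qed

text \<open>The bound on N excludes p = 5, where the polynomial is (1 + 2T + 2T^2)/5 and integrality
  fails.\<close>

lemma eis_poly_p_local:
  assumes "prime p" "p = 2 * N + 3" "N \<ge> 2"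
  shows "coeff (eis_poly N) k \<in> p_local p"
proof -
  note of_int = p_local_of_int[OF assms(1)]
  have ints: "coeff [:1, 2, 2:] k \<in> p_local p" "coeff [:0, 0, 0, 0, - 4:] k \<in> p_local p" for k
    using of_int[of 0] of_int[of 1] of_int[of 2] of_int[of "- 4"]
    by (auto simp: coeff_pCons split: nat.split)
  have "fps_nth (fps_of_poly [:0, 0, 0, 0, - 4:] ^ i) k \<in> p_local p" for i k
    using ints by (intro p_local_fps_power assms) simp
  then have "coeff (\<Sum>i<N. [:0, 0, 0, 0, - 4:] ^ i) k \<in> p_local p" for k
    unfolding coeff_sum by (intro p_local_sum assms) (simp flip: fps_of_poly_power)
  then have "fps_nth (fps_of_poly [:1, 2, 2:] * fps_of_poly (\<Sum>i<N. [:0, 0, 0, 0, - 4:] ^ i)) k \<in> p_local p" for k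
    using ints by (intro p_local_fps_mult assms) simp_all
  then have "coeff ([:1, 2, 2:] * (\<Sum>i<N. [:0, 0, 0, 0, - 4:] ^ i)) k \<in> p_local p"
    by (simp only: fps_of_poly_mult[symmetric] fps_of_poly_nth)
  then show ?thesis
    unfolding eis_poly_def coeff_smult using eis_const_p_local[OF assms] p_local_mult assms(1) by blast
qed

section \<open>Theta series\<close>

text \<open>This is the theta series over S with equal powers of Q collected; its coefficients are
  integers because they are cardinalities.\<close>

definition theta_fps :: "int set \<Rightarrow> complex fps" where
  "theta_fps S = Abs_fps (\<lambda>k. of_nat (card {b \<in> S. nat (b\<^sup>2) = k}))"

text \<open>As |b| is at most b^2, the terms are dominated by |q|^|b|, that is, by geometric series
  over the nonnegative and the nonpositive integers.\<close>

lemma summable_power_square_int: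
  fixes q :: complex
  assumes "norm q < 1"
  shows "(\<lambda>b. q ^ nat (b\<^sup>2)) summable_on (S :: int set)"
proof -
  have geo: "(\<lambda>n. norm q ^ n) summable_on UNIV"
    using assms by (intro norm_summable_imp_summable_on) (simp add: summable_geometric norm_power)
  have le: "norm q ^ nat (b\<^sup>2) \<le> norm q ^ nat \<bar>b\<bar>" for b :: int
  proof (rule power_decreasing)
    have "\<bar>b\<bar> * 1 \<le> \<bar>b\<bar> * \<bar>b\<bar>" if "b \<noteq> 0"
      using that by (intro mult_left_mono) auto
    then show "nat \<bar>b\<bar> \<le> nat (b\<^sup>2)"
      by (cases "b = 0") (auto simp: power2_eq_square abs_mult_self_eq intro!: nat_mono)
  qed (use assms in auto)
  have "(\<lambda>b. norm q ^ nat \<bar>b\<bar>) summable_on (range int)"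
    using geo by (subst summable_on_reindex) (auto simp: o_def)
  moreover have "(\<lambda>b. norm q ^ nat \<bar>b\<bar>) summable_on (range (\<lambda>n. - int n))"
    using geo by (subst summable_on_reindex) (auto simp: o_def inj_on_def)
  ultimately have "(\<lambda>b. norm q ^ nat \<bar>b\<bar>) summable_on (range int \<union> range (\<lambda>n. - int n))"
    by (rule summable_on_union)
  moreover have "b \<in> range int \<union> range (\<lambda>n. - int n)" for b
    by (cases b rule: int_cases2) auto
  then have "range int \<union> range (\<lambda>n. - int n) = UNIV"
    by blast
  ultimately have "(\<lambda>b :: int. norm q ^ nat \<bar>b\<bar>) summable_on UNIV"
    by simp
  then have "(\<lambda>b :: int. norm (q ^ nat (b\<^sup>2))) summable_on UNIV"
    by (rule summable_on_comparison_test) (simp_all add: norm_power le)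
  then have "(\<lambda>b. q ^ nat (b\<^sup>2)) summable_on (UNIV :: int set)"
    by (rule abs_summable_summable)
  then show ?thesis
    by (rule summable_on_subset_banach) simp
qed

text \<open>The sum over S is split along the fibres of the squaring map. Each fibre is finite,
  since |b| is at most b^2 = k, and contributes its cardinality times q^k.\<close>

lemma theta_fps_sums:
  assumes "norm q < 1"
  shows "(\<lambda>k. fps_nth (theta_fps S) k * q ^ k) sums (\<Sum>\<^sub>\<infinity>b\<in>S. q ^ nat (b\<^sup>2))"
proof -
  let ?B = "\<lambda>k. {b \<in> S. nat (b\<^sup>2) = k}"
  have "((\<lambda>b. q ^ nat (b\<^sup>2)) has_sum (\<Sum>\<^sub>\<infinity>b\<in>S. q ^ nat (b\<^sup>2))) S"
    by (rule has_sum_infsum[OF summable_power_square_int[OF assms]])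
  moreover have "((\<lambda>b. q ^ nat (b\<^sup>2)) has_sum s) S \<longleftrightarrow>
      ((\<lambda>(k, b). q ^ k) has_sum s) (Sigma UNIV ?B)" for s
    by (rule has_sum_reindex_bij_witness[where i = snd and j = "\<lambda>b. (nat (b\<^sup>2), b)"]) auto
  ultimately have "((\<lambda>(k, b). q ^ k) has_sum (\<Sum>\<^sub>\<infinity>b\<in>S. q ^ nat (b\<^sup>2))) (Sigma UNIV ?B)"
    by simp
  moreover have "((\<lambda>b. case (k, b) of (k, b) \<Rightarrow> q ^ k) has_sum fps_nth (theta_fps S) k * q ^ k) (?B k)" for k
  proof -
    have "?B k \<subseteq> {- int k..int k}"
    proof
      fix b assume "b \<in> ?B k"
      then have "\<bar>b\<bar> * \<bar>b\<bar> = int k"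
        by (auto simp: power2_eq_square)
      moreover have "\<bar>b\<bar> * 1 \<le> \<bar>b\<bar> * \<bar>b\<bar>" if "b \<noteq> 0"
        using that by (intro mult_left_mono) auto
      ultimately show "b \<in> {- int k..int k}"
        by (cases "b = 0") auto
    qed
    then have "finite (?B k)"
      by (rule finite_subset) simp
    then show ?thesis
      using has_sum_finite[of "?B k" "\<lambda>_. q ^ k"] by (simp add: theta_fps_def)
  qed
  ultimately have "((\<lambda>k. fps_nth (theta_fps S) k * q ^ k) has_sum (\<Sum>\<^sub>\<infinity>b\<in>S. q ^ nat (b\<^sup>2))) UNIV"
    by (rule has_sum_SigmaD)
  then show ?thesis
    by (rule has_sum_imp_sums)
qed

lemma theta_fps_conv_radius: "fps_conv_radius (theta_fps S) \<ge> 1"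
  unfolding fps_conv_radius_def
proof (rule conv_radius_geI_ex')
  fix r :: real assume "0 < r" "ereal r < 1"
  then have "norm (of_real r :: complex) < 1"
    by simp
  then show "summable (\<lambda>n. fps_nth (theta_fps S) n * of_real r ^ n)"
    using theta_fps_sums sums_summable by blast
qed

lemma theta_exp: "exp (of_real pi * \<i> * of_int b ^ 2 * \<tau> / 2) = exp (of_real pi * \<i> * \<tau> / 2) ^ nat (b\<^sup>2)"
proof -
  have "of_nat (nat (b\<^sup>2)) = (of_int b ^ 2 :: complex)"
    by (simp flip: of_int_power)
  then show ?thesis
    by (simp add: algebra_simps flip: exp_of_nat_mult)
qed

lemma norm_nome_less_1:
  assumes "Im \<tau> > 0"
  shows "norm (exp (of_real pi * \<i> * \<tau> / 2)) < 1"
  using assms by simp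

lemma eval_theta_fps:
  assumes "norm q < 1"
  shows "eval_fps (theta_fps S) q = (\<Sum>\<^sub>\<infinity>b\<in>S. q ^ nat (b\<^sup>2))"
  using theta_fps_sums[OF assms] by (simp add: eval_fps_def sums_iff)

text \<open>Both theta series converge for |q| < 1, which covers the whole upper half plane. Their
  products may therefore be expanded formally, as power series products.\<close>

lemma form_theta_Q_expansion:
  defines "A \<equiv> theta_fps {b. b mod 2 = 0}" and "B \<equiv> theta_fps {b. b mod 2 = 1}"
  shows "is_Q_expansion (\<lambda>\<tau>. eval2 (form l w) (theta0 \<tau>) (theta1 \<tau>))
    (fps_nth (\<Sum>j\<le>l. fps_const (w j) * (A ^ (l - j) * B ^ j)))"
  unfolding is_Q_expansion_def
proof (intro allI impI)
  fix \<tau> :: complex assume \<tau>: "Im \<tau> > 0"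
  define q where "q = exp (of_real pi * \<i> * \<tau> / 2)"
  have q: "norm q < 1"
    unfolding q_def by (rule norm_nome_less_1[OF \<tau>])
  have theta: "theta0 \<tau> = eval_fps A q" "theta1 \<tau> = eval_fps B q"
    unfolding theta0_def theta1_def theta_exp A_def B_def eval_theta_fps[OF q] by (simp_all only: q_def)
  have rad: "norm q < fps_conv_radius F" if "fps_conv_radius F \<ge> 1" for F :: "complex fps"
    using q that by (metis ereal_less(3) less_le_trans)
  have A: "fps_conv_radius (A ^ i) \<ge> 1" and B: "fps_conv_radius (B ^ i) \<ge> 1" for i
    using theta_fps_conv_radius fps_conv_radius_power order_trans unfolding A_def B_def by blast+
  have "(\<lambda>k. fps_nth (A ^ i * B ^ j) k * q ^ k) sums (theta0 \<tau> ^ i * theta1 \<tau> ^ j)" for i j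
  proof -
    have "norm q < fps_conv_radius (A ^ i * B ^ j)"
      using A[of i] B[of j] fps_conv_radius_mult[of "A ^ i" "B ^ j"] by (intro rad) (meson min.boundedI order_trans)
    then have "(\<lambda>k. fps_nth (A ^ i * B ^ j) k * q ^ k) sums eval_fps (A ^ i * B ^ j) q"
      by (rule sums_eval_fps)
    moreover have "eval_fps (A ^ i * B ^ j) q = eval_fps A q ^ i * eval_fps B q ^ j"
      using A[of 1] B[of 1] by (simp add: eval_fps_mult eval_fps_power rad A B)
    ultimately show ?thesis
      by (simp only: theta)
  qed
  then have "(\<lambda>k. \<Sum>j\<le>l. w j * (fps_nth (A ^ (l - j) * B ^ j) k * q ^ k)) sums
      (\<Sum>j\<le>l. w j * (theta0 \<tau> ^ (l - j) * theta1 \<tau> ^ j))"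
    by (intro sums_sum sums_mult)
  then show "(\<lambda>k. fps_nth (\<Sum>j\<le>l. fps_const (w j) * (A ^ (l - j) * B ^ j)) k
      * exp (of_real pi * \<i> * \<tau> / 2) ^ k) sums eval2 (form l w) (theta0 \<tau>) (theta1 \<tau>)"
    unfolding q_def[symmetric]
    by (simp add: eval2_form fps_sum_nth sum_distrib_right mult.assoc)
qed

lemma form_theta_p_local:
  assumes "prime p" "\<And>j. w j \<in> p_local p"
  shows "fps_nth (\<Sum>j\<le>l. fps_const (w j) * (theta_fps S ^ (l - j) * theta_fps T ^ j)) k \<in> p_local p"
proof -
  have theta: "fps_nth (theta_fps S) k \<in> p_local p" for S k
    by (simp add: theta_fps_def p_local_of_nat[OF assms(1)])
  have "fps_nth (theta_fps S ^ (l - j) * theta_fps T ^ j) k \<in> p_local p" for j k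
    by (intro p_local_fps_mult p_local_fps_power assms(1) theta)
  then show ?thesis
    unfolding fps_sum_nth fps_mult_left_const_nth by (intro p_local_sum p_local_mult assms)
qed

theorem theorem1p4:
  shows
    "(\<forall>l>0. phi l \<noteq> 0 \<longrightarrow> (\<forall>z. poly (P_phi l) z = 0 \<longrightarrow> cmod z = 1 / sqrt 2)) \<and>
     (\<forall>l>0. phi l \<noteq> 0 \<and> phi (l + 4) \<noteq> 0 \<longrightarrow>
        interlace_on_circle (1 / sqrt 2) (P_phi l) (P_phi (l + 4))) \<and>
     (\<forall>p::nat. prime p \<and> p \<ge> 7 \<longrightarrow>
        (\<forall>k. p_integral p (coeff (P_phi (2 * (p - 1))) k))) \<and>
     (\<forall>p::nat. prime p \<and> p \<ge> 5 \<longrightarrow>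
        (\<forall>i j. p_integral p (coeff2 (phi_normalized (2 * (p - 1))) i j))) \<and>
     (\<forall>p::nat. prime p \<and> p \<ge> 5 \<longrightarrow>
        (\<exists>c. is_Q_expansion
               (\<lambda>\<tau>. eval2 (phi_normalized (2 * (p - 1))) (theta0 \<tau>) (theta1 \<tau>)) c \<and>
             (\<forall>k. p_integral p (c k))))"
proof (intro conjI allI impI)
  fix l :: nat and z
  assume "l > 0" "phi l \<noteq> 0" and z: "poly (P_phi l) z = 0"
  then obtain N where N: "N \<ge> 1" "l = 4 * N + 4"
    using phi_nonzero_imp by blast
  show "cmod z = 1 / sqrt 2"
    using eis_poly_zero_norm[OF N(1)] z by (simp add: N P_phi_eq[OF N(1)])
next
  fix l :: nat
  assume "l > 0" "phi l \<noteq> 0 \<and> phi (l + 4) \<noteq> 0"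
  then obtain N where N: "N \<ge> 1" "l = 4 * N + 4"
    using phi_nonzero_imp by blast
  have "P_phi (l + 4) = eis_poly (N + 1)"
    using P_phi_eq[of "N + 1"] N by (simp add: algebra_simps)
  then show "interlace_on_circle (1 / sqrt 2) (P_phi l) (P_phi (l + 4))"
    using eis_poly_interlace[OF N(1)] by (simp add: N P_phi_eq[OF N(1)])
next
  fix p k :: nat
  assume p: "prime p \<and> p \<ge> 7"
  then obtain N where N: "N \<ge> 1" "p = 2 * N + 3" "2 * (p - 1) = 4 * N + 4"
    using prime_ge_5_cases[of p] by auto
  have "coeff (eis_poly N) k \<in> p_local p"
    \<comment> \<open>From p \<ge> 7 and p = 2N + 3 follows N \<ge> 2.\<close>
    using p N by (intro eis_poly_p_local) auto
  then show "p_integral p (coeff (P_phi (2 * (p - 1))) k)"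
    unfolding N(3) P_phi_eq[OF N(1)] using p p_local_p_integral by blast
next
  fix p i j :: nat
  assume p: "prime p \<and> p \<ge> 5"
  then obtain N where N: "N \<ge> 1" "p = 2 * N + 3" "2 * (p - 1) = 4 * N + 4"
    using prime_ge_5_cases[of p] by auto
  have "coeff2 (form (4 * N + 4) (eis_weight N)) i j \<in> p_local p"
    \<comment> \<open>The integer 0 covers the pairs i, j whose sum is not the degree.\<close>
    using p N eis_weight_p_local[of p N j] p_local_of_int[of p 0] by (auto simp: coeff2_form)
  then show "p_integral p (coeff2 (phi_normalized (2 * (p - 1))) i j)"
    unfolding N(3) phi_normalized_eq[OF N(1)] using p p_local_p_integral by blast
next
  fix p :: nat
  assume p: "prime p \<and> p \<ge> 5"
  then obtain N where N: "N \<ge> 1" "p = 2 * N + 3" "2 * (p - 1) = 4 * N + 4"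
    using prime_ge_5_cases[of p] by auto
  have "eis_weight N j \<in> p_local p" for j
    using p N eis_weight_p_local by blast
  then show "\<exists>c. is_Q_expansion
      (\<lambda>\<tau>. eval2 (phi_normalized (2 * (p - 1))) (theta0 \<tau>) (theta1 \<tau>)) c \<and> (\<forall>k. p_integral p (c k))"
    unfolding N(3) phi_normalized_eq[OF N(1)]
    using form_theta_Q_expansion form_theta_p_local p_local_p_integral p by blast
qed

end
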